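(* Let $K, N \in \mathbb{N}$ with $K \leq N$. Let $I_1, \ldots, I_K$ be distinct intervals from the collection $[\frac{\ell}{N}, \frac{\ell+1}{N})$, $\ell = 0, \ldots, N-1$, and for each $k \in \{1,\ldots,K\}$ let $S_k$ be a union of a subcollection of $I_1, \ldots, I_K$ which includes $I_k$. Then there exists a permutation $\rho$ of $\{1,\ldots,K\}$ such that \[ \bigcup_{k=1}^{K} \mathcal{E}\big( S_k,\, N\mathbb{Z} + \rho(k) \big) =\bigcup_{k=1}^{K}\big\{ e^{2\pi i \lambda (\cdot)}\chi_{S_k} : \lambda\in N\mathbb{Z} + \rho(k) \big\} \] is a Riesz basis for $L^2\big(\bigcup_{k=1}^{K} S_k\big)$.
   Context: For a measurable set $S \subset \mathbb{R}$ and a discrete set $\Lambda \subset \mathbb{R}$, $\mathcal{E}(S,\Lambda) := \{ e^{2\pi i \lambda (\cdot)} \chi_{S} : \lambda \in \Lambda \}$, where $\chi_S$ is the characteristic function of $S$. Such systems (and their unions) are regarded as families indexed by the frequencies $\lambda$; here the cosets $N\mathbb{Z}+\rho(k)$ are pairwise disjoint. A Riesz basis for a separable Hilbert space $\mathcal{H}$ is a sequence of the form $\{U e_n\}$, where $\{e_n\}$ is an orthonormal basis for $\mathcal{H}$ and $U:\mathcal{H}\to\mathcal{H}$ is a bijective bounded operator; equivalently, it is a complete sequence $\{f_n\}$ in $\mathcal{H}$ for which there are constants $0<A\le B<\infty$ with $A\|c\|_{\ell_2}^2 \le \|\sum_n c_n f_n\|^2 \le B\|c\|_{\ell_2}^2$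 for all $c=\{c_n\}\in\ell_2$. *)

theory Defs
  imports "HOL-Analysis.Analysis" "HOL-Combinatorics.Permutations"
begin

text \<open>
  Elements of \<open>L\<^sup>2(M)\<close> are represented by square-integrable functions; equality in \<open>L\<^sup>2(M)\<close> is
  equality almost everywhere, so operators on \<open>L\<^sup>2(M)\<close> are required to respect it.
\<close>

definition L2 :: "'a measure \<Rightarrow> ('a \<Rightarrow> complex) set" where
  "L2 M = {f \<in> borel_measurable M. integrable M (\<lambda>x. (cmod (f x))\<^sup>2)}"

definition L2_inner :: "'a measure \<Rightarrow> ('a \<Rightarrow> complex) \<Rightarrow> ('a \<Rightarrow> complex) \<Rightarrow> complex" where
  "L2_inner M f g = (LINT x|M. f x * cnj (g x))"

definition L2_norm :: "'a measure \<Rightarrow> ('a \<Rightarrow> complex) \<Rightarrow> real" where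
  "L2_norm M f = sqrt (LINT x|M. (cmod (f x))\<^sup>2)"

definition L2_eq :: "'a measure \<Rightarrow> ('a \<Rightarrow> complex) \<Rightarrow> ('a \<Rightarrow> complex) \<Rightarrow> bool" where
  "L2_eq M f g \<longleftrightarrow> (AE x in M. f x = g x)"

definition L2_orthonormal_basis ::
    "'a measure \<Rightarrow> 'i set \<Rightarrow> ('i \<Rightarrow> 'a \<Rightarrow> complex) \<Rightarrow> bool" where
  "L2_orthonormal_basis M J e \<longleftrightarrow>
     countable J \<and>
     (\<forall>i\<in>J. e i \<in> L2 M) \<and>
     (\<forall>i\<in>J. \<forall>j\<in>J. L2_inner M (e i) (e j) = (if i = j then 1 else 0)) \<and>
     (\<forall>f\<in>L2 M. \<forall>\<epsilon>>0. \<exists>F c. finite F \<and> F \<subseteq> J \<and>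
        L2_norm M (\<lambda>x. f x - (\<Sum>i\<in>F. c i * e i x)) < \<epsilon>)"

definition L2_bounded_operator ::
    "'a measure \<Rightarrow> (('a \<Rightarrow> complex) \<Rightarrow> ('a \<Rightarrow> complex)) \<Rightarrow> bool" where
  "L2_bounded_operator M U \<longleftrightarrow>
     (\<forall>f\<in>L2 M. U f \<in> L2 M) \<and>
     (\<forall>f\<in>L2 M. \<forall>g\<in>L2 M. L2_eq M f g \<longrightarrow> L2_eq M (U f) (U g)) \<and>
     (\<forall>f\<in>L2 M. \<forall>g\<in>L2 M. L2_eq M (U (\<lambda>x. f x + g x)) (\<lambda>x. U f x + U g x)) \<and>
     (\<forall>c. \<forall>f\<in>L2 M. L2_eq M (U (\<lambda>x. c * f x)) (\<lambda>x. c * U f x)) \<and>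
     (\<exists>C. \<forall>f\<in>L2 M. L2_norm M (U f) \<le> C * L2_norm M f)"

definition L2_bijective ::
    "'a measure \<Rightarrow> (('a \<Rightarrow> complex) \<Rightarrow> ('a \<Rightarrow> complex)) \<Rightarrow> bool" where
  "L2_bijective M U \<longleftrightarrow>
     (\<forall>f\<in>L2 M. \<forall>g\<in>L2 M. L2_eq M (U f) (U g) \<longrightarrow> L2_eq M f g) \<and>
     (\<forall>g\<in>L2 M. \<exists>f\<in>L2 M. L2_eq M (U f) g)"

definition L2_Riesz_basis ::
    "'a measure \<Rightarrow> 'i set \<Rightarrow> ('i \<Rightarrow> 'a \<Rightarrow> complex) \<Rightarrow> bool" where
  "L2_Riesz_basis M J f \<longleftrightarrow>
     (\<forall>i\<in>J. f i \<in> L2 M) \<and>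
     (\<exists>e U. L2_orthonormal_basis M J e \<and> L2_bounded_operator M U \<and> L2_bijective M U \<and>
        (\<forall>i\<in>J. L2_eq M (f i) (U (e i))))"

definition exponential :: "real set \<Rightarrow> real \<Rightarrow> real \<Rightarrow> complex" where
  "exponential S \<xi> x = exp (2 * complex_of_real pi * \<i> * of_real \<xi> * of_real x) * indicator S x"

definition int_coset :: "nat \<Rightarrow> nat \<Rightarrow> real set" where
  "int_coset N r = {real N * of_int m + real r | m :: int. True}"

definition grid_intervals :: "nat \<Rightarrow> real set set" where
  "grid_intervals N = {{real l / real N ..< (real l + 1) / real N} | l. l < N}"

end

theory Submission
  imports Defs "Jordan_Normal_Form.Determinant"
begin

text \<open>
  Write \<open>w\<^sub>j = exp (2 \<pi> i d\<^sub>j)\<close> with \<open>d\<^sub>j\<close> the left endpoint of \<open>I\<^sub>j\<close>. On \<open>I\<^sub>j\<close> the exponential of frequency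
  \<open>\<xi> \<in> N\<int> + \<rho>(k)\<close> is \<open>(w\<^sub>j / w\<^sub>k) ^ \<rho>(k)\<close> times the translate of its restriction to \<open>I\<^sub>k\<close>. Hence the family
  is the image of the orthonormal basis \<open>sqrt N exp (2 \<pi> i \<xi> x) \<chi>\<close> (\<open>\<chi>\<close> the indicator of \<open>I\<^sub>k\<close>,
  \<open>\<xi> \<in> N\<int> + \<rho>(k)\<close>) under an operator that, up to the factor \<open>sqrt N\<close>, acts on the vector of restrictions to
  the intervals as the \<open>K \<times> K\<close> matrix with entries \<open>[I\<^sub>j \<subseteq> S\<^sub>k] (w\<^sub>j / w\<^sub>k) ^ \<rho>(k)\<close>, and it suffices to choose
  \<open>\<rho>\<close> so that \<open>D(\<rho>) = det ([I\<^sub>j \<subseteq> S\<^sub>k] w\<^sub>j ^ \<rho>(k))\<close> is nonzero. Such a \<open>\<rho>\<close> exists because the sum of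
  \<open>sgn(\<rho>) D(\<rho>)\<close> over all \<open>\<rho>\<close> is the permanent of the 0-1 matrix \<open>[I\<^sub>j \<subseteq> S\<^sub>k]\<close>, which is positive since its
  diagonal is 1, times the Vandermonde determinant \<open>det (w\<^sub>j ^ r)\<close>.
\<close>

section \<open>A permutation with nonvanishing determinant\<close>

text \<open>In the signed sum over \<open>p\<close> of the Leibniz expansions, each fixed
  \<open>\<sigma>\<close> contributes the full determinant of \<open>W\<close> if it respects the
  pattern \<open>A\<close>, and 0 otherwise. The sum is therefore a count of permutations times a
  nonzero determinant. The count includes the identity, and characteristic 0 keeps it nonzero in the
  field.\<close>

lemma exists_permuted_det_neq_0:
  fixes W :: "'a :: field_char_0 mat"
  assumes W: "W \<in> carrier_mat n n" and det: "Determinant.det W \<noteq> 0"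
    and A: "\<And>k. k < n \<Longrightarrow> k \<in> A k"
  obtains p where "p permutes {0..<n}"
    "Determinant.det (Matrix.mat n n (\<lambda>(k, j). of_bool (j \<in> A k) * W $$ (p k, j))) \<noteq> 0"
proof -
  let ?P = "{p. p permutes {0..<n}}"
  define M where "M p = Matrix.mat n n (\<lambda>(k, j). of_bool (j \<in> A k) * W $$ (p k, j))" for p
  have fin: "finite ?P" by (rule finite_permutations) simp
  have detM: "Determinant.det (M p) = (\<Sum>\<sigma>\<in>?P. signof \<sigma> * (of_bool (\<forall>k<n. \<sigma> k \<in> A k) * (\<Prod>k=0..<n. W $$ (p k, \<sigma> k))))" for p
  proof -
    have "(\<Prod>k = 0..<n. M p $$ (k, \<sigma> k)) = of_bool (\<forall>k<n. \<sigma> k \<in> A k) * (\<Prod>k=0..<n. W $$ (p k, \<sigma> k))"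
      if "\<sigma> \<in> ?P" for \<sigma>
    proof -
      have "\<sigma> k < n" if "k < n" for k
        using permutes_in_image[of \<sigma> "{0..<n}" k] \<open>\<sigma> \<in> ?P\<close> that by auto
      then have "(\<Prod>k = 0..<n. M p $$ (k, \<sigma> k)) = (\<Prod>k = 0..<n. of_bool (\<sigma> k \<in> A k) * W $$ (p k, \<sigma> k))"
        by (intro prod.cong) (auto simp: M_def)
      also have "\<dots> = (\<Prod>k = 0..<n. of_bool (\<sigma> k \<in> A k)) * (\<Prod>k=0..<n. W $$ (p k, \<sigma> k))"
        by (rule prod.distrib)
      also have "(\<Prod>k = 0..<n. of_bool (\<sigma> k \<in> A k)) = (of_bool (\<forall>k<n. \<sigma> k \<in> A k) :: 'a)"
        by (cases "\<forall>k<n. \<sigma> k \<in> A k") auto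
      finally show ?thesis .
    qed
    then show ?thesis
      by (subst det_def'[of _ n]) (auto simp: M_def intro!: sum.cong)
  qed
  \<comment> \<open>Replacing \<open>p\<close> by \<open>p \<circ> \<sigma>\<close> cancels the sign
    of \<open>\<sigma>\<close>, and reindexing the product by \<open>i = \<sigma> k\<close> removes
    \<open>\<sigma>\<close> from the entries, so the result does not depend on
    \<open>\<sigma>\<close>.\<close>
  have inner: "(\<Sum>p\<in>?P. signof p * (signof \<sigma> * (\<Prod>k=0..<n. W $$ (p k, \<sigma> k)))) = Determinant.det W"
    if \<sigma>: "\<sigma> \<in> ?P" for \<sigma>
  proof -
    have "(\<Sum>p\<in>?P. signof p * (signof \<sigma> * (\<Prod>k=0..<n. W $$ (p k, \<sigma> k))))
        = (\<Sum>p\<in>?P. signof (p \<circ> \<sigma>) * (signof \<sigma> * (\<Prod>k=0..<n. W $$ ((p \<circ> \<sigma>) k, \<sigma> k))))"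
      using \<sigma> by (intro sum_permutations_compose_right) auto
    also have "\<dots> = (\<Sum>p\<in>?P. signof p * (\<Prod>i=0..<n. W $$ (p i, i)))"
    proof (rule sum.cong[OF refl])
      fix p assume p: "p \<in> ?P"
      have "signof (p \<circ> \<sigma>) * signof \<sigma> = (signof p :: 'a)"
        using p \<sigma> by (subst sign_compose) (auto simp: permutes_imp_permutation[of "{0..<n}"] sign_def)
      moreover have "(\<Prod>k=0..<n. W $$ ((p \<circ> \<sigma>) k, \<sigma> k)) = (\<Prod>i=0..<n. W $$ (p i, i))"
        using prod.permute[of \<sigma> "{0..<n}" "\<lambda>i. W $$ (p i, i)"] \<sigma> by (simp add: o_def)
      ultimately show "signof (p \<circ> \<sigma>) * (signof \<sigma> * (\<Prod>k=0..<n. W $$ ((p \<circ> \<sigma>) k, \<sigma> k)))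
          = signof p * (\<Prod>i=0..<n. W $$ (p i, i))"
        by (simp only: mult.assoc[symmetric])
    qed
    also have "\<dots> = Determinant.det W"
      using W by (simp add: det_col atLeast0LessThan)
    finally show ?thesis .
  qed
  have "(\<Sum>p\<in>?P. signof p * Determinant.det (M p))
      = (\<Sum>\<sigma>\<in>?P. of_bool (\<forall>k<n. \<sigma> k \<in> A k) * (\<Sum>p\<in>?P. signof p * (signof \<sigma> * (\<Prod>k=0..<n. W $$ (p k, \<sigma> k)))))"
    unfolding detM sum_distrib_left by (subst sum.swap) (simp only: mult.left_commute)
  also have "\<dots> = (\<Sum>\<sigma>\<in>?P. of_bool (\<forall>k<n. \<sigma> k \<in> A k) * Determinant.det W)"
    by (rule sum.cong[OF refl]) (simp only: inner)
  also have "\<dots> = of_nat (card {\<sigma>\<in>?P. \<forall>k<n. \<sigma> k \<in> A k}) * Determinant.det W"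
    using fin by (simp add: Int_def flip: sum_distrib_right)
  also have "\<dots> \<noteq> 0"
  proof -
    have "id \<in> {\<sigma>\<in>?P. \<forall>k<n. \<sigma> k \<in> A k}"
      using A by (auto simp: permutes_id)
    then have "card {\<sigma>\<in>?P. \<forall>k<n. \<sigma> k \<in> A k} \<noteq> 0"
      using fin by (metis (no_types, lifting) card_0_eq empty_iff finite_subset mem_Collect_eq subsetI)
    then show ?thesis using det by simp
  qed
  finally obtain p where "p \<in> ?P" "signof p * Determinant.det (M p) \<noteq> 0"
    by (meson sum.not_neutral_contains_not_neutral)
  then show ?thesis using that by (auto simp: M_def)
qed

text \<open>A kernel vector of the transpose is the coefficient vector of a polynomial of degree
  below \<open>n\<close> that vanishes at the \<open>n\<close> distinct points \<open>w j\<close>.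
  The exponents start at 1 because \<open>\<rho>\<close> takes values in \<open>{1..K}\<close>; this
  puts an extra factor \<open>w j\<close> into each evaluation, which is cancelled using
  \<open>w j \<noteq> 0\<close>.\<close>

lemma vandermonde_det_neq_0:
  fixes w :: "nat \<Rightarrow> 'a :: field"
  assumes inj: "inj_on w {0..<n}" and nz: "\<And>j. j < n \<Longrightarrow> w j \<noteq> 0"
  shows "Determinant.det (Matrix.mat n n (\<lambda>(r, j). w j ^ Suc r)) \<noteq> 0"
proof
  define V where "V = Matrix.mat n n (\<lambda>(j, r). w j ^ Suc r)"
  have V: "V \<in> carrier_mat n n" by (simp add: V_def)
  have "Matrix.mat n n (\<lambda>(r, j). w j ^ Suc r) = transpose_mat V"
    by (rule eq_matI) (auto simp: V_def)
  moreover assume "Determinant.det (Matrix.mat n n (\<lambda>(r, j). w j ^ Suc r)) = 0"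
  ultimately have "Determinant.det V = 0"
    using V by (simp add: Determinant.det_transpose)
  then obtain v where v: "v \<in> carrier_vec n" "v \<noteq> 0\<^sub>v n" "V *\<^sub>v v = 0\<^sub>v n"
    using det_0_iff_vec_prod_zero[OF V] by auto
  define p where "p = (\<Sum>r<n. monom (vec_index v r) r)"
  have coeff: "coeff p r = (if r < n then vec_index v r else 0)" for r
    by (auto simp: p_def coeff_sum)
  have roots: "poly p (w j) = 0" if "j < n" for j
  proof -
    have "0 = vec_index (V *\<^sub>v v) j" using v that by simp
    also have "\<dots> = (\<Sum>r=0..<n. w j ^ Suc r * vec_index v r)"
      using that v(1) by (simp add: V_def scalar_prod_def del: power_Suc)
    also have "\<dots> = w j * poly p (w j)"
      by (simp add: p_def poly_sum poly_monom sum_distrib_left atLeast0LessThan mult_ac)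
    finally show ?thesis using nz[OF that] by simp
  qed
  have "n \<noteq> 0"
    using v by auto
  have deg: "degree p \<le> n - 1"
    by (intro degree_le allI impI) (auto simp: coeff)
  have "p = 0"
  proof (rule ccontr)
    assume "p \<noteq> 0"
    have "n = card (w ` {0..<n})" using inj by (simp add: card_image)
    also have "\<dots> \<le> card {x. poly p x = 0}"
      using \<open>p \<noteq> 0\<close> roots by (intro card_mono poly_roots_finite) auto
    also have "\<dots> \<le> degree p" by (rule card_poly_roots_bound[OF \<open>p \<noteq> 0\<close>])
    finally show False using deg \<open>n \<noteq> 0\<close> by simp
  qed
  then have "vec_index v r = 0" if "r < n" for r
    using coeff[of r] that by simp
  then show False using v by (auto intro!: eq_vecI)
qed

text \<open>With \<open>M\<close> the matrix of nonzero determinant and \<open>D\<close> the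
  diagonal matrix of the \<open>w k ^ \<rho> k\<close>, the matrix in the sums is the transpose of
  \<open>M\<close> times the inverse of \<open>D\<close>. Its two-sided inverse \<open>b\<close> is
  \<open>D\<close> times the transpose of the inverse of \<open>M\<close>.\<close>

lemma exists_permuted_inverse:
  fixes w :: "nat \<Rightarrow> 'a :: field_char_0"
  assumes inj: "inj_on w {1..K}" and nz: "\<And>j. j \<in> {1..K} \<Longrightarrow> w j \<noteq> 0"
    and A: "\<And>k. k \<in> {1..K} \<Longrightarrow> k \<in> A k"
  obtains \<rho> b where "\<rho> permutes {1..K}"
    "\<And>i j. i \<in> {1..K} \<Longrightarrow> j \<in> {1..K} \<Longrightarrow>
      (\<Sum>k\<in>{1..K}. of_bool (i \<in> A k) * w i ^ \<rho> k / w k ^ \<rho> k * b k j) = of_bool (i = j)"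
    "\<And>i j. i \<in> {1..K} \<Longrightarrow> j \<in> {1..K} \<Longrightarrow>
      (\<Sum>k\<in>{1..K}. b i k * (of_bool (k \<in> A j) * w k ^ \<rho> j / w j ^ \<rho> j)) = of_bool (i = j)"
proof -
  let ?W = "Matrix.mat K K (\<lambda>(r, j). w (Suc j) ^ Suc r)"
  have detW: "Determinant.det ?W \<noteq> 0"
  proof (rule vandermonde_det_neq_0)
    have "inj_on (w \<circ> Suc) {0..<K}"
      using inj by (intro comp_inj_on) (simp_all add: image_Suc_atLeastLessThan atLeastLessThanSuc_atLeastAtMost)
    then show "inj_on (\<lambda>j. w (Suc j)) {0..<K}" by (simp add: o_def)
  qed (simp add: nz)
  have AS: "k \<in> {j. Suc j \<in> A (Suc k)}" if "k < K" for k
    using A[of "Suc k"] that by auto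
  obtain p where p: "p permutes {0..<K}" and
    det: "Determinant.det (Matrix.mat K K (\<lambda>(k, j). of_bool (j \<in> {j. Suc j \<in> A (Suc k)}) * ?W $$ (p k, j))) \<noteq> 0"
    by (rule exists_permuted_det_neq_0[OF mat_carrier detW AS])
  define M where "M = Matrix.mat K K (\<lambda>(k, j). of_bool (Suc j \<in> A (Suc k)) * w (Suc j) ^ Suc (p k))"
  have pK: "p k < K" if "k < K" for k
    using permutes_in_image[OF p, of k] that by auto
  have "Matrix.mat K K (\<lambda>(k, j). of_bool (j \<in> {j. Suc j \<in> A (Suc k)}) * ?W $$ (p k, j)) = M"
    by (rule eq_matI) (auto simp: M_def pK)
  with det have detM: "Determinant.det M \<noteq> 0" by simp
  have M: "M \<in> carrier_mat K K" by (simp add: M_def)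
  from det_non_zero_imp_unit[OF M detM, of "()"] obtain B where
    B: "B \<in> carrier_mat K K" "B * M = 1\<^sub>m K" "M * B = 1\<^sub>m K"
    by (auto simp: Units_def ring_mat_def)
  \<comment> \<open>Matrices are indexed from 0, the intervals from 1: \<open>\<rho>\<close> is
    \<open>p\<close> conjugated by the successor map, and the identity outside
    \<open>{1..K}\<close>, as \<open>permutes\<close> demands.\<close>
  define \<rho> where "\<rho> k = (if k \<in> {1..K} then Suc (p (k - 1)) else k)" for k
  have S: "{1..K} = Suc ` {0..<K}" by (simp add: image_Suc_atLeastLessThan atLeastLessThanSuc_atLeastAtMost)
  have \<rho>_Suc: "\<rho> (Suc k) = Suc (p k)" if "k < K" for k
    using that by (simp add: \<rho>_def)
  have "\<rho> permutes {1..K}"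
  proof (rule bij_imp_permutes)
    have "inj_on \<rho> {1..K}"
      using permutes_inj[OF p] by (auto intro!: inj_onI simp: \<rho>_def inj_eq)
    moreover have "\<rho> ` {1..K} \<subseteq> {1..K}"
      using pK by (fastforce simp: \<rho>_def Suc_le_eq)
    ultimately show "bij_betw \<rho> {1..K} {1..K}"
      by (simp add: bij_betw_def endo_inj_surj)
  qed (auto simp: \<rho>_def)
  moreover define b where "b i j = w i ^ \<rho> i * B $$ (j - 1, i - 1)" for i j
  have sumS: "(\<Sum>k\<in>{1..K}. f k) = (\<Sum>k=0..<K. f (Suc k))" for f :: "nat \<Rightarrow> 'a"
    by (subst S, subst sum.reindex) (simp_all add: o_def)
  have "(\<Sum>k\<in>{1..K}. of_bool (i \<in> A k) * w i ^ \<rho> k / w k ^ \<rho> k * b k j) = of_bool (i = j)"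
    if ij: "i \<in> {1..K}" "j \<in> {1..K}" for i j
  proof -
    obtain i' j' where ij': "i = Suc i'" "j = Suc j'" "i' < K" "j' < K"
      using ij unfolding S by (elim imageE) auto
    have "(\<Sum>k\<in>{1..K}. of_bool (i \<in> A k) * w i ^ \<rho> k / w k ^ \<rho> k * b k j) = (\<Sum>k=0..<K. B $$ (j', k) * M $$ (k, i'))"
      unfolding sumS using ij' nz by (intro sum.cong) (auto simp: b_def M_def \<rho>_Suc)
    also have "\<dots> = (B * M) $$ (j', i')"
      using ij' B(1) M by (simp add: scalar_prod_def)
    finally show ?thesis using ij' B by auto
  qed
  moreover have "(\<Sum>k\<in>{1..K}. b i k * (of_bool (k \<in> A j) * w k ^ \<rho> j / w j ^ \<rho> j)) = of_bool (i = j)"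
    if ij: "i \<in> {1..K}" "j \<in> {1..K}" for i j
  proof -
    obtain i' j' where ij': "i = Suc i'" "j = Suc j'" "i' < K" "j' < K"
      using ij unfolding S by (elim imageE) auto
    have "(\<Sum>k\<in>{1..K}. b i k * (of_bool (k \<in> A j) * w k ^ \<rho> j / w j ^ \<rho> j))
        = (\<Sum>k=0..<K. M $$ (j', k) * B $$ (k, i')) * (w i ^ \<rho> i / w j ^ \<rho> j)"
      unfolding sumS sum_distrib_right using ij' by (intro sum.cong) (auto simp: b_def M_def \<rho>_Suc)
    also have "(\<Sum>k=0..<K. M $$ (j', k) * B $$ (k, i')) = (M * B) $$ (j', i')"
      using ij' B(1) M by (simp add: scalar_prod_def)
    finally show ?thesis using ij' B nz by auto
  qed
  ultimately show ?thesis by (rule that)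
qed

section \<open>Square-integrable functions and bounded operators\<close>

lemma L2_measurable: "f \<in> L2 M \<Longrightarrow> f \<in> borel_measurable M"
  by (simp add: L2_def)

lemma L2_integrable: "f \<in> L2 M \<Longrightarrow> integrable M (\<lambda>x. (cmod (f x))\<^sup>2)"
  by (simp add: L2_def)

lemma cmod_add_power2_le: "(cmod (a + b))\<^sup>2 \<le> 2 * (cmod a)\<^sup>2 + 2 * (cmod b)\<^sup>2"
proof -
  have "(cmod (a + b))\<^sup>2 \<le> (cmod a + cmod b)\<^sup>2"
    by (intro power_mono norm_triangle_ineq) auto
  also have "\<dots> \<le> 2 * (cmod a)\<^sup>2 + 2 * (cmod b)\<^sup>2"
    using sum_squares_bound[of "cmod a" "cmod b"] by (simp add: power2_sum)
  finally show ?thesis .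
qed

lemma L2_add:
  assumes f: "f \<in> L2 M" and g: "g \<in> L2 M"
  shows "(\<lambda>x. f x + g x) \<in> L2 M"
proof -
  note [measurable] = L2_measurable[OF f] L2_measurable[OF g]
  have "integrable M (\<lambda>x. (cmod (f x + g x))\<^sup>2)"
    by (rule Bochner_Integration.integrable_bound[where f = "\<lambda>x. 2 * (cmod (f x))\<^sup>2 + 2 * (cmod (g x))\<^sup>2"])
      (use f g cmod_add_power2_le in \<open>auto simp: L2_integrable\<close>)
  then show ?thesis by (simp add: L2_def)
qed

lemma L2_cmult: "f \<in> L2 M \<Longrightarrow> (\<lambda>x. c * f x) \<in> L2 M"
  by (auto simp: L2_def norm_mult power_mult_distrib)

lemma L2_diff: "f \<in> L2 M \<Longrightarrow> g \<in> L2 M \<Longrightarrow> (\<lambda>x. f x - g x) \<in> L2 M"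
  using L2_add[OF _ L2_cmult[of g M "-1"]] by simp

lemma L2_zero: "(\<lambda>x. 0) \<in> L2 M"
  by (simp add: L2_def)

lemma L2_sum: "(\<And>i. i \<in> A \<Longrightarrow> f i \<in> L2 M) \<Longrightarrow> (\<lambda>x. \<Sum>i\<in>A. f i x) \<in> L2 M"
  by (induction A rule: infinite_finite_induct) (auto simp: L2_zero L2_add)

lemma L2_norm_nonneg [simp]: "L2_norm M f \<ge> 0"
  by (simp add: L2_norm_def)

lemma L2_norm_cmult: "L2_norm M (\<lambda>x. c * f x) = cmod c * L2_norm M f"
  by (simp add: L2_norm_def norm_mult power_mult_distrib real_sqrt_mult)

text \<open>The factor 2 spares us Minkowski's inequality.\<close>

lemma L2_norm_add_le:
  assumes f: "f \<in> L2 M" and g: "g \<in> L2 M"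
  shows "L2_norm M (\<lambda>x. f x + g x) \<le> 2 * (L2_norm M f + L2_norm M g)"
proof -
  have "(LINT x|M. (cmod (f x + g x))\<^sup>2) \<le> (LINT x|M. 2 * (cmod (f x))\<^sup>2 + 2 * (cmod (g x))\<^sup>2)"
    using f g L2_add[OF f g] cmod_add_power2_le by (intro integral_mono) (auto simp: L2_integrable)
  also have "\<dots> = 2 * (LINT x|M. (cmod (f x))\<^sup>2) + 2 * (LINT x|M. (cmod (g x))\<^sup>2)"
    using f g by (simp add: L2_integrable)
  also have "\<dots> \<le> 4 * (LINT x|M. (cmod (f x))\<^sup>2) + 4 * (LINT x|M. (cmod (g x))\<^sup>2)"
    by (intro add_mono mult_right_mono) auto
  finally have "L2_norm M (\<lambda>x. f x + g x)
      \<le> sqrt (4 * (LINT x|M. (cmod (f x))\<^sup>2) + 4 * (LINT x|M. (cmod (g x))\<^sup>2))"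
    by (simp add: L2_norm_def)
  also have "\<dots> \<le> sqrt (4 * (LINT x|M. (cmod (f x))\<^sup>2)) + sqrt (4 * (LINT x|M. (cmod (g x))\<^sup>2))"
    by (intro sqrt_add_le_add_sqrt) auto
  finally show ?thesis by (simp add: L2_norm_def real_sqrt_mult)
qed

lemma L2_eq_refl [simp]: "L2_eq M f f"
  by (simp add: L2_eq_def)

lemma L2_bounded_operatorI:
  assumes "\<And>f. f \<in> L2 M \<Longrightarrow> U f \<in> L2 M"
    and "\<And>f g. f \<in> L2 M \<Longrightarrow> g \<in> L2 M \<Longrightarrow> L2_eq M f g \<Longrightarrow> L2_eq M (U f) (U g)"
    and "\<And>f g. f \<in> L2 M \<Longrightarrow> g \<in> L2 M \<Longrightarrow> L2_eq M (U (\<lambda>x. f x + g x)) (\<lambda>x. U f x + U g x)"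
    and "\<And>f c. f \<in> L2 M \<Longrightarrow> L2_eq M (U (\<lambda>x. c * f x)) (\<lambda>x. c * U f x)"
    and "\<And>f. f \<in> L2 M \<Longrightarrow> L2_norm M (U f) \<le> C * L2_norm M f"
  shows "L2_bounded_operator M U"
  unfolding L2_bounded_operator_def using assms by (intro conjI ballI allI impI exI[of _ C])

section \<open>Bounded operators: closure under finite linear combinations\<close>

lemma L2_bounded_operator_zero: "L2_bounded_operator M (\<lambda>f x. 0)"
  by (auto simp: L2_bounded_operator_def L2_zero L2_norm_def intro!: exI[of _ 0])

lemma L2_bounded_operator_cmult:
  assumes "L2_bounded_operator M U"
  shows "L2_bounded_operator M (\<lambda>f x. c * U f x)"
proof -
  obtain C where C: "\<forall>f\<in>L2 M. L2_norm M (U f) \<le> C * L2_norm M f"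
    using assms by (auto simp: L2_bounded_operator_def)
  have bound: "L2_norm M (\<lambda>x. c * U f x) \<le> cmod c * C * L2_norm M f" if "f \<in> L2 M" for f
    using C that by (simp add: L2_norm_cmult mult_left_mono mult.assoc)
  have add: "L2_eq M (\<lambda>x. c * U (\<lambda>x. f x + g x) x) (\<lambda>x. c * U f x + c * U g x)"
    if "f \<in> L2 M" "g \<in> L2 M" for f g
  proof -
    have "AE x in M. U (\<lambda>x. f x + g x) x = U f x + U g x"
      using assms that by (auto simp: L2_bounded_operator_def L2_eq_def)
    then show ?thesis unfolding L2_eq_def by eventually_elim (simp add: algebra_simps)
  qed
  have cmult: "L2_eq M (\<lambda>x. c * U (\<lambda>x. d * f x) x) (\<lambda>x. d * (c * U f x))"
    if "f \<in> L2 M" for f d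
  proof -
    have "AE x in M. U (\<lambda>x. d * f x) x = d * U f x"
      using assms that by (auto simp: L2_bounded_operator_def L2_eq_def)
    then show ?thesis unfolding L2_eq_def by eventually_elim simp
  qed
  have cong: "L2_eq M (\<lambda>x. c * U f x) (\<lambda>x. c * U g x)"
    if "f \<in> L2 M" "g \<in> L2 M" "L2_eq M f g" for f g
  proof -
    have "AE x in M. U f x = U g x"
      using assms that by (auto simp: L2_bounded_operator_def L2_eq_def)
    then show ?thesis unfolding L2_eq_def by eventually_elim simp
  qed
  have closed: "(\<lambda>x. c * U f x) \<in> L2 M" if "f \<in> L2 M" for f
    using assms that by (auto simp: L2_bounded_operator_def L2_cmult)
  show ?thesis
    by (rule L2_bounded_operatorI[OF closed cong add cmult bound])
qed

lemma L2_bounded_operator_add: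
  assumes U: "L2_bounded_operator M U" and V: "L2_bounded_operator M V"
  shows "L2_bounded_operator M (\<lambda>f x. U f x + V f x)"
proof -
  obtain C where C: "\<forall>f\<in>L2 M. L2_norm M (U f) \<le> C * L2_norm M f"
    using U by (auto simp: L2_bounded_operator_def)
  obtain D where D: "\<forall>f\<in>L2 M. L2_norm M (V f) \<le> D * L2_norm M f"
    using V by (auto simp: L2_bounded_operator_def)
  \<comment> \<open>The constant is twice the sum of the two bounds because of the factor 2 in
    \<open>L2_norm_add_le\<close>.\<close>
  have bound: "L2_norm M (\<lambda>x. U f x + V f x) \<le> 2 * (C + D) * L2_norm M f" if "f \<in> L2 M" for f
  proof -
    have "L2_norm M (\<lambda>x. U f x + V f x) \<le> 2 * (L2_norm M (U f) + L2_norm M (V f))"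
      using that U V by (intro L2_norm_add_le) (auto simp: L2_bounded_operator_def)
    also have "\<dots> \<le> 2 * (C + D) * L2_norm M f"
      using C D that by (simp add: algebra_simps add_mono)
    finally show ?thesis .
  qed
  have cong: "L2_eq M (\<lambda>x. U f x + V f x) (\<lambda>x. U g x + V g x)"
    if "f \<in> L2 M" "g \<in> L2 M" "L2_eq M f g" for f g
  proof -
    have "AE x in M. U f x = U g x" "AE x in M. V f x = V g x"
      using U V that by (auto simp: L2_bounded_operator_def L2_eq_def)
    then show ?thesis unfolding L2_eq_def by eventually_elim simp
  qed
  have add: "L2_eq M (\<lambda>x. U (\<lambda>x. f x + g x) x + V (\<lambda>x. f x + g x) x)
      (\<lambda>x. (U f x + V f x) + (U g x + V g x))"
    if "f \<in> L2 M" "g \<in> L2 M" for f g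
  proof -
    have "AE x in M. U (\<lambda>x. f x + g x) x = U f x + U g x"
      "AE x in M. V (\<lambda>x. f x + g x) x = V f x + V g x"
      using U V that by (auto simp: L2_bounded_operator_def L2_eq_def)
    then show ?thesis unfolding L2_eq_def by eventually_elim simp
  qed
  have cmult: "L2_eq M (\<lambda>x. U (\<lambda>x. c * f x) x + V (\<lambda>x. c * f x) x) (\<lambda>x. c * (U f x + V f x))"
    if "f \<in> L2 M" for f c
  proof -
    have "AE x in M. U (\<lambda>x. c * f x) x = c * U f x" "AE x in M. V (\<lambda>x. c * f x) x = c * V f x"
      using U V that by (auto simp: L2_bounded_operator_def L2_eq_def)
    then show ?thesis unfolding L2_eq_def by eventually_elim (simp add: algebra_simps)
  qed
  have closed: "(\<lambda>x. U f x + V f x) \<in> L2 M" if "f \<in> L2 M" for f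
    using U V that by (auto simp: L2_bounded_operator_def L2_add)
  show ?thesis
    by (rule L2_bounded_operatorI[OF closed cong add cmult bound])
qed

lemma L2_bounded_operator_sum:
  "finite A \<Longrightarrow> (\<And>i. i \<in> A \<Longrightarrow> L2_bounded_operator M (U i)) \<Longrightarrow>
    L2_bounded_operator M (\<lambda>f x. \<Sum>i\<in>A. U i f x)"
  by (induction A rule: finite_induct) (auto simp: L2_bounded_operator_zero L2_bounded_operator_add)

text \<open>An inverse up to null sets suffices. A bounded operator \<open>V\<close> respects
  almost-everywhere equality, so from \<open>U f\<close> and \<open>U g\<close> agreeing almost
  everywhere one passes to \<open>V (U f)\<close> and \<open>V (U g)\<close>, hence to
  \<open>f\<close> and \<open>g\<close>.\<close>

lemma L2_bijectiveI:
  assumes V: "L2_bounded_operator M V"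
    and VU: "\<And>f. f \<in> L2 M \<Longrightarrow> L2_eq M (V (U f)) f"
    and UV: "\<And>f. f \<in> L2 M \<Longrightarrow> L2_eq M (U (V f)) f"
    and U: "\<And>f. f \<in> L2 M \<Longrightarrow> U f \<in> L2 M"
  shows "L2_bijective M U"
  unfolding L2_bijective_def
proof (intro conjI ballI impI)
  fix f g assume fg: "f \<in> L2 M" "g \<in> L2 M" "L2_eq M (U f) (U g)"
  then have "AE x in M. V (U f) x = V (U g) x"
    using V U by (auto simp: L2_bounded_operator_def L2_eq_def)
  moreover have "AE x in M. V (U f) x = f x" "AE x in M. V (U g) x = g x"
    using VU fg by (auto simp: L2_eq_def)
  ultimately show "L2_eq M f g"
    unfolding L2_eq_def by eventually_elim simp
next
  fix g assume "g \<in> L2 M"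
  then show "\<exists>f\<in>L2 M. L2_eq M (U f) g"
    using V UV by (auto simp: L2_bounded_operator_def)
qed

lemma L2_Riesz_basis_cong:
  assumes "L2_Riesz_basis M J f" and "\<And>i. i \<in> J \<Longrightarrow> g i = f i"
  shows "L2_Riesz_basis M J g"
  using assms by (simp add: L2_Riesz_basis_def)

section \<open>Translations of null sets and translations as bounded operators\<close>

lemma AE_lebesgue_translation:
  fixes a :: "'a :: euclidean_space"
  assumes "AE x in lebesgue. P x"
  shows "AE x in lebesgue. P (x + a)"
proof -
  \<comment> \<open>The exceptional set is covered by a null set of \<open>lborel\<close>, which can
    be translated; completeness of Lebesgue measure then disposes of its subsets.\<close>
  obtain N where N: "N \<in> null_sets lborel" "{x. \<not> P x} \<subseteq> N"
    using AE_completion_iff[THEN iffD1, OF assms] unfolding eventually_ae_filter by auto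
  then have "{x. x - (-a) \<in> N} \<in> null_sets lborel"
    by (intro null_sets_translation)
  moreover have "{x. \<not> P (x + a)} \<subseteq> {x. x - (-a) \<in> N}"
    using N(2) by auto
  ultimately show ?thesis
    by (intro AE_completion_iff[THEN iffD2]) (auto simp: eventually_ae_filter)
qed

text \<open>Extended by zero off \<open>\<Omega>\<close>, a function can be translated on the whole
  line without change of norm, and restricting the result to \<open>B\<close> can only decrease the
  norm. Hence the operator bound is 1.\<close>

lemma L2_bounded_operator_translation:
  fixes \<Omega> B :: "real set" and c :: real
  assumes \<Omega>: "\<Omega> \<in> sets lebesgue" and B: "B \<in> sets lebesgue" and "B \<subseteq> \<Omega>"
    and shift: "\<And>x. x \<in> B \<Longrightarrow> x + c \<in> \<Omega>"
  shows "L2_bounded_operator (lebesgue_on \<Omega>) (\<lambda>f x. indicator B x * f (x + c))"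
proof -
  let ?M = "lebesgue_on \<Omega>" and ?U = "\<lambda>(f :: real \<Rightarrow> complex) x. indicator B x * f (x + c)"
  have bound: "?U f \<in> L2 ?M \<and> L2_norm ?M (?U f) \<le> L2_norm ?M f" if f: "f \<in> L2 ?M" for f
  proof -
    define F where "F = (\<lambda>x. indicator \<Omega> x * f x)"
    have "F \<in> borel_measurable lebesgue"
      using L2_measurable[OF f] \<Omega>
      by (simp add: F_def borel_measurable_restrict_space_iff scaleR_conv_of_real of_real_indicator)
    \<comment> \<open>The shift is written as the affine map \<open>c + 1 * x\<close> so that the
      affine change of variables for Lebesgue measure applies, with Jacobian 1.\<close>
    then have G: "(\<lambda>x. F (c + 1 * x)) \<in> borel_measurable lebesgue"
      by (rule measurable_compose[rotated]) (use lebesgue_affine_measurable[where c = "\<lambda>_. 1::real" and t = c] in simp)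
    have F2: "(cmod (F x))\<^sup>2 = indicator \<Omega> x *\<^sub>R (cmod (f x))\<^sup>2" for x
      by (simp add: F_def indicator_def)
    have intF: "integrable lebesgue (\<lambda>x. (cmod (F x))\<^sup>2)"
      using L2_integrable[OF f] \<Omega> by (simp add: F2 integrable_restrict_space)
    then have intG: "integrable lebesgue (\<lambda>x. (cmod (F (c + 1 * x)))\<^sup>2)"
      by (rule lebesgue_integrable_real_affine) simp
    have eq: "indicator B x * f (x + c) = indicator B x * F (c + 1 * x)" for x
      using shift[of x] by (simp add: F_def indicator_def add.commute)
    have meas: "(\<lambda>x. indicator B x * F (c + 1 * x)) \<in> borel_measurable lebesgue"
      using G B by (intro borel_measurable_times borel_measurable_indicator) auto
    have intB: "integrable lebesgue (\<lambda>x. (cmod (indicator B x * F (c + 1 * x)))\<^sup>2)"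
      by (rule Bochner_Integration.integrable_bound[OF intG])
        (use meas in \<open>auto simp: indicator_def\<close>)
    have ind: "indicator \<Omega> x *\<^sub>R (cmod (indicator B x * F (c + 1 * x)))\<^sup>2 = (cmod (indicator B x * F (c + 1 * x)))\<^sup>2" for x
      using \<open>B \<subseteq> \<Omega>\<close> by (auto simp: indicator_def)
    have "integrable ?M (\<lambda>x. (cmod (indicator B x * F (c + 1 * x)))\<^sup>2)"
      using intB \<Omega> by (subst integrable_restrict_space) (simp, simp only: ind)
    then have "?U f \<in> L2 ?M"
      using meas
      unfolding L2_def eq by (simp add: measurable_restrict_space1)
    moreover have "(LINT x|?M. (cmod (?U f x))\<^sup>2) \<le> (LINT x|?M. (cmod (f x))\<^sup>2)"
    proof -
      have "(LINT x|?M. (cmod (?U f x))\<^sup>2) = (LINT x|lebesgue. (cmod (indicator B x * F (c + 1 * x)))\<^sup>2)"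
        using \<Omega> unfolding eq by (subst integral_restrict_space) (simp, simp only: ind)
      also have "\<dots> \<le> (LINT x|lebesgue. (cmod (F (c + 1 * x)))\<^sup>2)"
        using intB intG by (intro integral_mono) (auto simp: indicator_def)
      also have "\<dots> = (LINT x|lebesgue. (cmod (F x))\<^sup>2)"
        using lebesgue_integral_real_affine[of 1 "\<lambda>x. (cmod (F x))\<^sup>2" c] by simp
      also have "\<dots> = (LINT x|?M. (cmod (f x))\<^sup>2)"
        using \<Omega> by (subst integral_restrict_space) (simp_all add: F2)
      finally show ?thesis .
    qed
    ultimately show ?thesis by (simp add: L2_norm_def)
  qed
  have cong: "L2_eq ?M (?U f) (?U g)" if "L2_eq ?M f g" for f g
  proof -
    \<comment> \<open>Equality on \<open>\<Omega>\<close> is restated on the whole line, guarded by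
      membership, so that it can be translated. Points of \<open>B\<close> satisfy the guard after
      the shift, and off \<open>B\<close> both images vanish.\<close>
    have "AE x in lebesgue. x \<in> \<Omega> \<longrightarrow> f x = g x"
      using that \<Omega> by (simp add: L2_eq_def AE_restrict_space_iff)
    then have "AE x in lebesgue. x + c \<in> \<Omega> \<longrightarrow> f (x + c) = g (x + c)"
      by (rule AE_lebesgue_translation)
    then have "AE x in lebesgue. x \<in> \<Omega> \<longrightarrow> ?U f x = ?U g x"
      by eventually_elim (use shift in \<open>auto simp: indicator_def\<close>)
    then show ?thesis
      using \<Omega> by (simp add: L2_eq_def AE_restrict_space_iff)
  qed
  show ?thesis
    by (rule L2_bounded_operatorI[where C = 1]) (use bound cong in \<open>auto simp: algebra_simps\<close>)
qed

section \<open>Completeness of the trigonometric system\<close>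

definition laurent_on_circle :: "(complex \<Rightarrow> complex) \<Rightarrow> bool" where
  "laurent_on_circle f \<longleftrightarrow>
     (\<exists>F c. finite F \<and> (\<forall>z\<in>sphere 0 1. f z = (\<Sum>m\<in>F. c m * z powi (m::int))))"

lemma laurent_on_circle_add:
  assumes "laurent_on_circle f" "laurent_on_circle g"
  shows "laurent_on_circle (\<lambda>z. f z + g z)"
proof -
  obtain F c where F: "finite F" "\<And>z. z \<in> sphere 0 1 \<Longrightarrow> f z = (\<Sum>m\<in>F. c m * z powi m)"
    using assms by (auto simp: laurent_on_circle_def)
  obtain G d where G: "finite G" "\<And>z. z \<in> sphere 0 1 \<Longrightarrow> g z = (\<Sum>m\<in>G. d m * z powi m)"
    using assms by (auto simp: laurent_on_circle_def)
  let ?e = "\<lambda>m. (if m \<in> F then c m else 0) + (if m \<in> G then d m else 0)"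
  have "f z + g z = (\<Sum>m\<in>F \<union> G. ?e m * z powi m)" if "z \<in> sphere 0 1" for z
  proof -
    have "(\<Sum>m\<in>F. c m * z powi m) = (\<Sum>m\<in>F \<union> G. (if m \<in> F then c m else 0) * z powi m)"
      using F G by (intro sum.mono_neutral_cong_left) auto
    moreover have "(\<Sum>m\<in>G. d m * z powi m) = (\<Sum>m\<in>F \<union> G. (if m \<in> G then d m else 0) * z powi m)"
      using F G by (intro sum.mono_neutral_cong_left) auto
    ultimately show ?thesis
      using F(2)[OF that] G(2)[OF that] by (simp only: distrib_right sum.distrib)
  qed
  with F(1) G(1) show ?thesis
    unfolding laurent_on_circle_def by (intro exI[of _ "F \<union> G"] exI[of _ ?e]) auto
qed

lemma laurent_on_circle_monom: "laurent_on_circle (\<lambda>z. c * z powi m)"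
  unfolding laurent_on_circle_def by (intro exI[of _ "{m}"] exI[of _ "\<lambda>_. c"]) auto

lemma laurent_on_circle_sum:
  "finite A \<Longrightarrow> (\<And>i. i \<in> A \<Longrightarrow> laurent_on_circle (f i)) \<Longrightarrow> laurent_on_circle (\<lambda>z. \<Sum>i\<in>A. f i z)"
proof (induction A rule: finite_induct)
  case empty
  show ?case using laurent_on_circle_monom[of 0 0] by simp
qed (simp add: laurent_on_circle_add)

lemma laurent_on_circle_cong:
  "laurent_on_circle f \<Longrightarrow> (\<And>z. z \<in> sphere 0 1 \<Longrightarrow> g z = f z) \<Longrightarrow> laurent_on_circle g"
  by (auto simp: laurent_on_circle_def)

lemma laurent_on_circle_mult:
  assumes "laurent_on_circle f" "laurent_on_circle g"
  shows "laurent_on_circle (\<lambda>z. f z * g z)"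
proof -
  obtain F c where F: "finite F" "\<And>z. z \<in> sphere 0 1 \<Longrightarrow> f z = (\<Sum>m\<in>F. c m * z powi m)"
    using assms by (auto simp: laurent_on_circle_def)
  obtain G d where G: "finite G" "\<And>z. z \<in> sphere 0 1 \<Longrightarrow> g z = (\<Sum>m\<in>G. d m * z powi m)"
    using assms by (auto simp: laurent_on_circle_def)
  have "laurent_on_circle (\<lambda>z. \<Sum>m\<in>F. \<Sum>n\<in>G. c m * d n * z powi (m + n))"
    using F G by (intro laurent_on_circle_sum laurent_on_circle_monom) auto
  then show ?thesis
  proof (rule laurent_on_circle_cong)
    fix z :: complex assume z: "z \<in> sphere 0 1"
    then have "z \<noteq> 0" by auto
    then show "f z * g z = (\<Sum>m\<in>F. \<Sum>n\<in>G. c m * d n * z powi (m + n))"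
      unfolding F(2)[OF z] G(2)[OF z] sum_product
      by (intro sum.cong) (auto simp: power_int_add)
  qed
qed

text \<open>Polynomials in the real and imaginary parts become Laurent polynomials on the unit
  circle, since there the conjugate of \<open>z\<close> is its inverse. Sums and products preserve
  the property, so the linear functionals are the essential case.\<close>

lemma laurent_on_circle_real_polynomial:
  assumes "real_polynomial_function p"
  shows "laurent_on_circle (\<lambda>z. of_real (p z))"
  using assms
proof (induction rule: real_polynomial_function.induct)
  case (linear f)
  \<comment> \<open>These come from substituting \<open>Re z = (z + 1/z) / 2\<close> and
    \<open>Im z = (z - 1/z) / (2 * \<i>)\<close> into
    \<open>Re z * f 1 + Im z * f \<i>\<close>.\<close>
  let ?c = "(of_real (f 1) - \<i> * of_real (f \<i>)) / 2" and ?d = "(of_real (f 1) + \<i> * of_real (f \<i>)) / 2"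
  have "laurent_on_circle (\<lambda>z. ?c * z powi 1 + ?d * z powi (-1))"
    by (intro laurent_on_circle_add laurent_on_circle_monom)
  then show ?case
  proof (rule laurent_on_circle_cong)
    fix z :: complex assume z: "z \<in> sphere 0 1"
    have "z = Re z *\<^sub>R 1 + Im z *\<^sub>R \<i>"
      by (simp add: complex_eq_iff)
    then have "f z = f (Re z *\<^sub>R 1 + Im z *\<^sub>R \<i>)" by simp
    also have "\<dots> = Re z * f 1 + Im z * f \<i>"
      using linear by (simp add: bounded_linear.linear linear_add linear_scale)
    finally have fz: "f z = Re z * f 1 + Im z * f \<i>" .
    have "inverse z = cnj z"
      using z by (simp add: inverse_complex_def complex_eq_iff cmod_def)
    then have "?c * z powi 1 + ?d * z powi (-1) = ?c * z + ?d * cnj z"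
      by (simp add: power_int_minus)
    then show "of_real (f z) = ?c * z powi 1 + ?d * z powi (-1)"
      by (simp add: fz complex_eq_iff field_simps)
  qed
next
  case (const c)
  show ?case using laurent_on_circle_monom[of "of_real c" 0] by simp
qed (simp_all add: laurent_on_circle_add laurent_on_circle_mult)

lemma laurent_on_circle_polynomial:
  fixes g :: "complex \<Rightarrow> complex"
  assumes "polynomial_function g"
  shows "laurent_on_circle g"
proof -
  have "real_polynomial_function (Re \<circ> g)" "real_polynomial_function (Im \<circ> g)"
    using assms bounded_linear_Re bounded_linear_Im by (auto simp: polynomial_function_def)
  then have "laurent_on_circle (\<lambda>z. of_real ((Re \<circ> g) z) + \<i> * z powi 0 * of_real ((Im \<circ> g) z))"
    by (intro laurent_on_circle_add laurent_on_circle_mult laurent_on_circle_monom laurent_on_circle_real_polynomial)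
  then show ?thesis
    by (rule laurent_on_circle_cong) (simp add: complex_eq)
qed

text \<open>Since its end values agree, \<open>h\<close> descends to a continuous function on the
  unit circle. Stone-Weierstrass approximates it there by a polynomial in the real coordinates,
  which on the circle is a Laurent polynomial, that is, a trigonometric polynomial in
  \<open>x\<close>.\<close>

lemma periodic_uniform_approximation:
  fixes h :: "real \<Rightarrow> complex"
  assumes T: "T > 0" and h: "continuous_on {a..a + T} h" "h (a + T) = h a" and \<epsilon>: "\<epsilon> > 0"
  obtains F c where "finite F"
    "\<And>x. x \<in> {a..<a + T} \<Longrightarrow> cmod (h x - (\<Sum>m\<in>F. c m * exp (2 * pi * \<i> * of_int m * x / T))) < \<epsilon>"
proof -
  define p where "p t = h (a + T * t)" for t
  have "path p"
    unfolding path_def p_def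
    by (rule continuous_on_compose2[OF h(1)]) (use T in \<open>auto intro!: continuous_intros mult_left_le\<close>)
  moreover have "pathfinish p = pathstart p"
    using h by (simp add: p_def pathfinish_def pathstart_def)
  \<comment> \<open>\<open>Arg2pi\<close> jumps on the positive real axis, and only the closing of
    the loop makes the composite continuous. The constant homotopy gives this: homotopic loops
    induce homotopic, hence continuous, maps of the circle.\<close>
  ultimately have "homotopic_loops UNIV p p"
    by (simp add: homotopic_loops_refl)
  then have cont: "continuous_on (sphere 0 1) (p \<circ> (\<lambda>z. Arg2pi z / (2 * pi)))"
    using homotopic_loops_imp_homotopic_circlemaps homotopic_with_imp_continuous by blast
  obtain g where g: "polynomial_function g"
    "\<And>z. z \<in> sphere 0 1 \<Longrightarrow> cmod ((p \<circ> (\<lambda>z. Arg2pi z / (2 * pi))) z - g z) < \<epsilon>"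
    using Stone_Weierstrass_polynomial_function[OF compact_sphere cont \<epsilon>] by blast
  obtain F c where F: "finite F" "\<And>z. z \<in> sphere 0 1 \<Longrightarrow> g z = (\<Sum>m\<in>F. c m * z powi m)"
    using laurent_on_circle_polynomial[OF g(1)] by (auto simp: laurent_on_circle_def)
  show ?thesis
  proof (rule that[OF F(1)])
    fix x assume x: "x \<in> {a..<a + T}"
    define z where "z = exp (\<i> * of_real (2 * pi * (x - a) / T))"
    have z: "z \<in> sphere 0 1" by (simp add: z_def)
    have "pi * (x - a) < pi * T"
      using x by simp
    then have "Arg2pi z = 2 * pi * (x - a) / T"
      using x T unfolding z_def by (subst Arg2pi_exp) (auto simp: field_simps)
    then have "p (Arg2pi z / (2 * pi)) = h x"
      using T by (simp add: p_def)
    \<comment> \<open>The angle of \<open>z\<close> is measured from \<open>a\<close>, so each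
      monomial carries a phase that does not depend on \<open>x\<close>; it is absorbed into the
      coefficient.\<close>
    moreover have "z powi m = exp (- 2 * pi * \<i> * of_int m * a / T) * exp (2 * pi * \<i> * of_int m * x / T)" for m
    proof -
      have "z powi m = exp (of_int m * (\<i> * of_real (2 * pi * (x - a) / T)))"
        unfolding z_def by (simp add: exp_power_int)
      also have "of_int m * (\<i> * of_real (2 * pi * (x - a) / T))
          = - 2 * pi * \<i> * of_int m * a / T + 2 * pi * \<i> * of_int m * x / T"
        using T by (simp add: field_simps)
      finally show ?thesis by (simp only: exp_add)
    qed
    ultimately show "cmod (h x - (\<Sum>m\<in>F. (c m * exp (- 2 * pi * \<i> * of_int m * a / T)) * exp (2 * pi * \<i> * of_int m * x / T))) < \<epsilon>"
      using g(2)[OF z] F(2)[OF z] by (simp add: mult.assoc)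
  qed
qed

section \<open>From uniform to mean-square approximation over one period\<close>

definition trig_approximable :: "real \<Rightarrow> real \<Rightarrow> (real \<Rightarrow> complex) \<Rightarrow> bool" where
  "trig_approximable a T f \<longleftrightarrow> (\<forall>\<epsilon>>0. \<exists>F c. finite F \<and>
     L2_norm (lebesgue_on {a..<a + T}) (\<lambda>x. f x - (\<Sum>m\<in>F. c m * exp (2 * pi * \<i> * of_int m * x / T))) < \<epsilon>)"

lemma L2_bounded:
  assumes "finite_measure M" "f \<in> borel_measurable M" "\<And>x. x \<in> space M \<Longrightarrow> cmod (f x) \<le> B"
  shows "f \<in> L2 M"
proof -
  have "integrable M (\<lambda>x. (cmod (f x))\<^sup>2)"
    using assms by (intro finite_measure.integrable_const_bound[where B = "B\<^sup>2"] AE_I2) (auto intro: power_mono)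
  with assms show ?thesis by (simp add: L2_def)
qed

lemma L2_norm_le_bound:
  assumes M: "finite_measure M" and f: "f \<in> borel_measurable M" "\<And>x. x \<in> space M \<Longrightarrow> cmod (f x) \<le> B"
    and B: "B \<ge> 0"
  shows "L2_norm M f \<le> B * sqrt (measure M (space M))"
proof -
  interpret finite_measure M by fact
  have "(LINT x|M. (cmod (f x))\<^sup>2) \<le> (LINT x|M. B\<^sup>2)"
    using L2_integrable[OF L2_bounded[OF M f]] f by (intro integral_mono) (auto intro: power_mono)
  also have "\<dots> = B\<^sup>2 * measure M (space M)" by simp
  finally show ?thesis
    using B by (simp add: L2_norm_def real_le_lsqrt power_mult_distrib)
qed

text \<open>Dominated convergence for the squared errors, so the majorant \<open>w\<close> bounds
  squares.\<close>

lemma L2_norm_tendsto_0: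
  assumes s: "\<And>n. s n \<in> borel_measurable M" and f: "f \<in> borel_measurable M"
    and lim: "AE x in M. (\<lambda>n. s n x) \<longlonglongrightarrow> f x"
    and w: "integrable M w" "\<And>n. AE x in M. (cmod (f x - s n x))\<^sup>2 \<le> w x"
  shows "(\<lambda>n. L2_norm M (\<lambda>x. f x - s n x)) \<longlonglongrightarrow> 0"
proof -
  note [measurable] = s f
  have "(\<lambda>n. LINT x|M. (cmod (f x - s n x))\<^sup>2) \<longlonglongrightarrow> (LINT x|M. 0)"
  proof (rule integral_dominated_convergence[OF _ _ w(1)])
    show "AE x in M. (\<lambda>n. (cmod (f x - s n x))\<^sup>2) \<longlonglongrightarrow> 0"
      using lim
    proof eventually_elim
      case (elim x)
      have "(\<lambda>n. (cmod (f x - s n x))\<^sup>2) \<longlonglongrightarrow> (cmod (f x - f x))\<^sup>2"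
        by (intro tendsto_intros elim)
      then show ?case by simp
    qed
  qed (use w(2) in auto)
  then have "(\<lambda>n. sqrt (LINT x|M. (cmod (f x - s n x))\<^sup>2)) \<longlonglongrightarrow> sqrt 0"
    by (intro tendsto_real_sqrt) simp
  then show ?thesis by (simp add: L2_norm_def)
qed

abbreviation cell :: "real \<Rightarrow> real \<Rightarrow> real measure" where
  "cell a T \<equiv> lebesgue_on {a..<a + T}"

context
  fixes a T :: real
  assumes T: "T > 0"
begin

lemma finite_measure_cell: "finite_measure (cell a T)"
  by (intro finite_measure_lebesgue_on bounded_set_imp_lmeasurable) auto

lemma exp_in_L2: "(\<lambda>x. exp (2 * pi * \<i> * of_int m * of_real x / T)) \<in> L2 (cell a T)"
proof (rule L2_bounded[OF finite_measure_cell, where B = 1])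
  show "(\<lambda>x. exp (2 * pi * \<i> * of_int m * of_real x / T)) \<in> borel_measurable (cell a T)"
    using T by (intro continuous_imp_measurable_on_sets_lebesgue continuous_intros) auto
qed (simp add: norm_exp_eq_Re)

lemma trig_approximable_limit:
  assumes g: "\<And>n. g n \<in> L2 (cell a T)" "\<And>n. trig_approximable a T (g n)" and f: "f \<in> L2 (cell a T)"
    and lim: "(\<lambda>n. L2_norm (cell a T) (\<lambda>x. f x - g n x)) \<longlonglongrightarrow> 0"
  shows "trig_approximable a T f"
  unfolding trig_approximable_def
proof (intro allI impI)
  fix \<epsilon> :: real assume \<epsilon>: "\<epsilon> > 0"
  \<comment> \<open>A quarter of \<open>\<epsilon>\<close> for each of the two errors, because
    \<open>L2_norm_add_le\<close> doubles their sum.\<close>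
  obtain n where n: "L2_norm (cell a T) (\<lambda>x. f x - g n x) < \<epsilon> / 4"
    using order_tendstoD(2)[OF lim, of "\<epsilon> / 4"] \<epsilon> by (auto simp: eventually_sequentially)
  obtain F c where F: "finite F"
    "L2_norm (cell a T) (\<lambda>x. g n x - (\<Sum>m\<in>F. c m * exp (2 * pi * \<i> * of_int m * x / T))) < \<epsilon> / 4"
    using g(2)[of n] \<epsilon> unfolding trig_approximable_def by (meson divide_pos_pos zero_less_numeral)
  let ?P = "\<lambda>x::real. \<Sum>m\<in>F. c m * exp (2 * pi * \<i> * of_int m * x / T)"
  have "?P \<in> L2 (cell a T)"
    by (intro L2_sum L2_cmult exp_in_L2)
  then have "L2_norm (cell a T) (\<lambda>x. (f x - g n x) + (g n x - ?P x))
      \<le> 2 * (L2_norm (cell a T) (\<lambda>x. f x - g n x) + L2_norm (cell a T) (\<lambda>x. g n x - ?P x))"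
    using f g by (intro L2_norm_add_le L2_diff)
  also have "\<dots> < \<epsilon>"
  proof -
    have "u < \<epsilon> / 4 \<Longrightarrow> v < \<epsilon> / 4 \<Longrightarrow> 2 * (u + v) < \<epsilon>" for u v by simp
    then show ?thesis using n F(2) .
  qed
  finally show "\<exists>F c. finite F \<and> L2_norm (cell a T) (\<lambda>x. f x - (\<Sum>m\<in>F. c m * exp (2 * pi * \<i> * of_int m * x / T))) < \<epsilon>"
    using F(1) by auto
qed

lemma trig_approximable_continuous:
  assumes h: "continuous_on {a..a + T} h" "h (a + T) = h a"
  shows "trig_approximable a T h"
  unfolding trig_approximable_def
proof (intro allI impI)
  fix \<epsilon> :: real assume \<epsilon>: "\<epsilon> > 0"
  \<comment> \<open>A uniform error \<open>\<delta>\<close> costs a factor \<open>sqrt T\<close> in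
    norm; the extra 2 makes the final inequality strict.\<close>
  define \<delta> where "\<delta> = \<epsilon> / (2 * sqrt T)"
  have \<delta>: "\<delta> > 0" using \<epsilon> T by (simp add: \<delta>_def)
  obtain F c where F: "finite F"
    "\<And>x. x \<in> {a..<a + T} \<Longrightarrow> cmod (h x - (\<Sum>m\<in>F. c m * exp (2 * pi * \<i> * of_int m * x / T))) < \<delta>"
    using periodic_uniform_approximation[OF T h \<delta>] by blast
  let ?P = "\<lambda>x::real. \<Sum>m\<in>F. c m * exp (2 * pi * \<i> * of_int m * x / T)"
  have "?P \<in> L2 (cell a T)"
    by (intro L2_sum L2_cmult exp_in_L2)
  moreover have "h \<in> borel_measurable (cell a T)"
    by (intro continuous_imp_measurable_on_sets_lebesgue continuous_on_subset[OF h(1)]) auto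
  ultimately have "(\<lambda>x. h x - ?P x) \<in> borel_measurable (cell a T)"
    by (intro borel_measurable_diff) (auto simp: L2_measurable)
  then have "L2_norm (cell a T) (\<lambda>x. h x - ?P x) \<le> \<delta> * sqrt (measure (cell a T) (space (cell a T)))"
    using F(2) \<delta> by (intro L2_norm_le_bound[OF finite_measure_cell]) (auto intro: less_imp_le)
  also have "measure (cell a T) (space (cell a T)) = T"
    using T by (simp add: measure_restrict_space)
  also have "\<delta> * sqrt T < \<epsilon>"
    using T \<epsilon> by (simp add: \<delta>_def)
  finally show "\<exists>F c. finite F \<and> L2_norm (cell a T) (\<lambda>x. h x - (\<Sum>m\<in>F. c m * exp (2 * pi * \<i> * of_int m * x / T))) < \<epsilon>"
    using F(1) by auto
qed

text \<open>Measurability supplies continuous functions converging to \<open>f\<close> almost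
  everywhere. They are clipped to the ball of radius \<open>B\<close>, which provides a constant
  majorant, and multiplied by a cutoff vanishing at both ends, which makes them periodic.\<close>

lemma trig_approximable_bounded:
  assumes f: "f \<in> borel_measurable (cell a T)" and B: "\<And>x. x \<in> {a..<a + T} \<Longrightarrow> cmod (f x) \<le> B"
  shows "trig_approximable a T f"
proof -
  have B0: "B \<ge> 0" using B[of a] T norm_ge_zero[of "f a"] by (simp del: norm_ge_zero)
  have "f measurable_on {a..<a + T}"
    using f by (subst measurable_on_iff_borel_measurable) auto
  then obtain Z g where Z: "negligible Z" and g: "\<And>n. continuous_on UNIV (g n)"
    "\<And>x. x \<notin> Z \<Longrightarrow> (\<lambda>n. g n x) \<longlonglongrightarrow> (if x \<in> {a..<a + T} then f x else 0)"
    unfolding measurable_on_def by blast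
  \<comment> \<open>A continuous cutoff that is 0 at \<open>a\<close> and \<open>a + T\<close>, and
    at each interior point equals 1 for all large \<open>n\<close>.\<close>
  define cut where "cut n x = max 0 (min 1 (min (real n * (x - a)) (real n * (a + T - x))))" for n x
  \<comment> \<open>The nearest-point projection onto the ball is continuous and fixes the values of
    \<open>f\<close>, so clipping preserves convergence.\<close>
  let ?clip = "closest_point (cball 0 B)"
  define s where "s n x = of_real (cut n x) * ?clip (g n x)" for n x
  have clip: "continuous_on UNIV ?clip" "cmod (?clip y) \<le> B" "cmod y \<le> B \<Longrightarrow> ?clip y = y" for y :: complex
    using closest_point_in_set[of "cball 0 B" y] B0
    by (auto simp: closest_point_self intro!: continuous_on_closest_point)
  have cut: "0 \<le> cut n x" "cut n x \<le> 1" for n x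
    by (auto simp: cut_def)
  have s_bound: "cmod (s n x) \<le> B" for n x
    using mult_mono[OF cut(2) clip(2)] cut[of n x] by (simp add: s_def norm_mult)
  have s_cont: "continuous_on A (s n)" for n A
    unfolding s_def cut_def
    by (intro continuous_intros continuous_on_compose2[OF clip(1)] continuous_on_subset[OF g(1)]) auto
  have s_meas: "s n \<in> borel_measurable (cell a T)" for n
    by (intro continuous_imp_measurable_on_sets_lebesgue s_cont) auto
  have approx: "trig_approximable a T (s n)" for n
    by (rule trig_approximable_continuous[OF s_cont]) (simp add: s_def cut_def)
  have lim: "(\<lambda>n. s n x) \<longlonglongrightarrow> f x" if x: "x \<notin> Z" "x \<in> {a<..<a + T}" for x
  proof -
    have "(\<lambda>n. ?clip (g n x)) \<longlonglongrightarrow> ?clip (f x)"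
      using g(2)[OF x(1)] x(2) clip(1)
      by (intro isCont_tendsto_compose[where g = ?clip]) (auto simp: continuous_on_eq_continuous_at)
    moreover have "(\<lambda>n. cut n x) \<longlonglongrightarrow> 1"
    proof (rule tendsto_eventually)
      define k where "k = min (x - a) (a + T - x)"
      have k: "k > 0" using x(2) by (simp add: k_def)
      have "eventually (\<lambda>n. 1 / k \<le> real n) sequentially"
        using filterlim_real_sequentially by (auto simp: filterlim_at_top)
      then show "eventually (\<lambda>n. cut n x = 1) sequentially"
      proof eventually_elim
        case (elim n)
        then have n: "1 \<le> real n * k" using k by (simp add: field_simps)
        have "real n * k \<le> real n * (x - a)" "real n * k \<le> real n * (a + T - x)"
          by (auto simp: k_def intro!: mult_left_mono)
        with n show ?case by (simp add: cut_def)
      qed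
    qed
    ultimately have "(\<lambda>n. s n x) \<longlonglongrightarrow> of_real 1 * ?clip (f x)"
      unfolding s_def by (intro tendsto_intros)
    then show ?thesis using clip(3)[OF B] x(2) by simp
  qed
  have fL2: "f \<in> L2 (cell a T)"
    using f B by (intro L2_bounded[OF finite_measure_cell]) auto
  show ?thesis
  proof (rule trig_approximable_limit[OF _ approx fL2])
    show "s n \<in> L2 (cell a T)" for n
      using s_meas s_bound by (intro L2_bounded[OF finite_measure_cell])
    show "(\<lambda>n. L2_norm (cell a T) (\<lambda>x. f x - s n x)) \<longlonglongrightarrow> 0"
    proof (rule L2_norm_tendsto_0[OF s_meas f])
      \<comment> \<open>The left endpoint is discarded along with \<open>Z\<close>: it belongs to
        the cell, but the cutoff is 0 there for every \<open>n\<close>.\<close>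
      have "AE x in lebesgue. x \<notin> insert a Z"
        using Z by (intro AE_not_in) (simp add: negligible_iff_null_sets[symmetric])
      then have "AE x in cell a T. x \<notin> insert a Z"
        by (subst AE_restrict_space_iff) auto
      with AE_space show "AE x in cell a T. (\<lambda>n. s n x) \<longlonglongrightarrow> f x"
        by eventually_elim (rule lim, auto)
      show "integrable (cell a T) (\<lambda>x. (2 * B)\<^sup>2)"
        using finite_measure_cell by (simp add: finite_measure.integrable_const)
      show "AE x in cell a T. (cmod (f x - s n x))\<^sup>2 \<le> (2 * B)\<^sup>2" for n
      proof (rule AE_I2)
        fix x assume "x \<in> space (cell a T)"
        then have "cmod (f x - s n x) \<le> B + B"
          using B[of x] s_bound[of n x] norm_triangle_ineq4[of "f x" "s n x"] by simp
        then show "(cmod (f x - s n x))\<^sup>2 \<le> (2 * B)\<^sup>2"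
          by (intro power_mono) auto
      qed
    qed
  qed
qed

text \<open>Truncating where the modulus exceeds \<open>n\<close> leaves bounded functions. The
  error is either 0 or \<open>f\<close> itself, so its square is dominated by that of
  \<open>f\<close>.\<close>

lemma trig_approximable_L2:
  assumes f: "f \<in> L2 (cell a T)"
  shows "trig_approximable a T f"
proof -
  note [measurable] = L2_measurable[OF f]
  define g where "g n x = (if cmod (f x) \<le> real n then f x else 0)" for n x
  have meas: "g n \<in> borel_measurable (cell a T)" for n
    unfolding g_def by measurable
  have bound: "cmod (g n x) \<le> real n" for n x
    by (simp add: g_def)
  show ?thesis
  proof (rule trig_approximable_limit[OF _ trig_approximable_bounded[OF meas bound] f])
    show "g n \<in> L2 (cell a T)" for n
      by (rule L2_bounded[OF finite_measure_cell meas bound])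
    show "(\<lambda>n. L2_norm (cell a T) (\<lambda>x. f x - g n x)) \<longlonglongrightarrow> 0"
    proof (rule L2_norm_tendsto_0[OF meas])
      show "AE x in cell a T. (\<lambda>n. g n x) \<longlonglongrightarrow> f x"
      proof (rule AE_I2, rule tendsto_eventually)
        fix x
        have "eventually (\<lambda>n. cmod (f x) \<le> real n) sequentially"
          using filterlim_real_sequentially by (auto simp: filterlim_at_top)
        then show "eventually (\<lambda>n. g n x = f x) sequentially"
          by eventually_elim (simp add: g_def)
      qed
      show "integrable (cell a T) (\<lambda>x. (cmod (f x))\<^sup>2)"
        by (rule L2_integrable[OF f])
    qed (auto simp: g_def)
  qed
qed

end

section \<open>Functions on a union of grid intervals\<close>

lemma L2_subset:
  fixes f :: "real \<Rightarrow> complex"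
  assumes f: "f \<in> L2 (lebesgue_on A)" and A: "A \<in> sets lebesgue" and B: "B \<in> sets lebesgue" "B \<subseteq> A"
  shows "f \<in> L2 (lebesgue_on B)"
proof -
  have "set_integrable lebesgue A (\<lambda>x. (cmod (f x))\<^sup>2)"
    using L2_integrable[OF f] A by (simp add: set_integrable_def integrable_restrict_space)
  then have "set_integrable lebesgue B (\<lambda>x. (cmod (f x))\<^sup>2)"
    using B by (rule set_integrable_subset)
  moreover have "f \<in> borel_measurable (lebesgue_on B)"
    using L2_measurable[OF f] B(2) by (rule measurable_restrict_mono)
  ultimately show ?thesis
    using B by (simp add: L2_def set_integrable_def integrable_restrict_space)
qed

lemma L2_mult_unimodular:
  assumes "f \<in> L2 M" "g \<in> borel_measurable M" "\<And>x. cmod (g x) = 1"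
  shows "(\<lambda>x. g x * f x) \<in> L2 M"
  using assms by (auto simp: L2_def norm_mult)

section \<open>Square integrability of exponentials and their integral over a period\<close>

lemma exponential_measurable:
  assumes "S \<in> sets lebesgue" "A \<in> sets lebesgue"
  shows "exponential S \<xi> \<in> borel_measurable (lebesgue_on A)"
proof -
  have "(\<lambda>x. exp (2 * complex_of_real pi * \<i> * of_real \<xi> * of_real x)) \<in> borel_measurable (lebesgue_on A)"
    using assms by (intro continuous_imp_measurable_on_sets_lebesgue continuous_intros)
  moreover have "indicator S \<in> borel_measurable lebesgue"
    using assms by (intro borel_measurable_indicator)
  then have "(indicator S :: real \<Rightarrow> complex) \<in> borel_measurable (lebesgue_on A)"
    by (rule measurable_restrict_space1)
  ultimately show ?thesis
    unfolding exponential_def by (intro borel_measurable_times)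
qed

lemma norm_exponential_le: "cmod (exponential S \<xi> x) \<le> 1"
  by (simp add: exponential_def norm_mult indicator_def)

lemma exponential_L2:
  assumes "S \<in> sets lebesgue" "A \<in> lmeasurable"
  shows "exponential S \<xi> \<in> L2 (lebesgue_on A)"
  using assms norm_exponential_le
  by (intro L2_bounded[where B = 1] finite_measure_lebesgue_on exponential_measurable) (auto simp: fmeasurableD)

text \<open>The antiderivative \<open>exp (\<omega> * x) / \<omega>\<close> takes equal values at
  the two ends, because \<open>\<omega> * T\<close> is an integer multiple of
  \<open>2 * pi * \<i>\<close>.\<close>

lemma integral_exp_period:
  fixes a T :: real and m :: int
  assumes T: "T > 0" and m: "m \<noteq> 0"
  shows "(LINT x|lebesgue_on {a..<a + T}. exp (2 * pi * \<i> * of_int m * of_real x / T)) = 0"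
proof -
  let ?f = "\<lambda>x::real. exp (2 * pi * \<i> * of_int m * of_real x / T)"
  define \<omega> where "\<omega> = 2 * pi * \<i> * of_int m / T"
  have \<omega>: "\<omega> \<noteq> 0" using T m by (simp add: \<omega>_def)
  have f: "?f x = exp (\<omega> * of_real x)" for x
    by (simp add: \<omega>_def)
  have "((\<lambda>x. exp (\<omega> * of_real x)) has_integral (exp (\<omega> * of_real (a + T)) / \<omega> - exp (\<omega> * of_real a) / \<omega>)) {a..a + T}"
  proof (rule fundamental_theorem_of_calculus)
    fix x
    have "((\<lambda>z. exp (\<omega> * z) / \<omega>) has_field_derivative exp (\<omega> * of_real x)) (at (of_real x))"
      using \<omega> by (auto intro!: derivative_eq_intros)
    then show "((\<lambda>x. exp (\<omega> * of_real x) / \<omega>) has_vector_derivative exp (\<omega> * of_real x)) (at x within {a..a + T})"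
      by (rule has_vector_derivative_real_field)
  qed (use T in auto)
  also have "exp (\<omega> * of_real (a + T)) = exp (\<omega> * of_real a)"
  proof -
    have "\<omega> * of_real (a + T) = \<omega> * of_real a + 2 * of_int m * pi * \<i>"
      using T by (simp add: \<omega>_def field_simps)
    then show ?thesis
      by (simp only: exp_add exp_integer_2pi[OF Ints_of_int] mult_1_right)
  qed
  finally have "(?f has_integral 0) {a..a + T}"
    unfolding f by simp
  then have "(?f has_integral 0) {a..<a + T}"
    by (subst has_integral_spike_set_eq[where T = "{a..a + T}"]) (auto intro: negligible_subset[of "{a + T}"])
  moreover have "integrable (lebesgue_on {a..<a + T}) ?f"
  proof (rule finite_measure.integrable_const_bound[where B = 1])
    show "finite_measure (lebesgue_on {a..<a + T})"
      by (rule finite_measure_cell[OF T])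
    show "?f \<in> borel_measurable (lebesgue_on {a..<a + T})"
      by (rule L2_measurable[OF exp_in_L2[OF T]])
  qed (simp add: norm_exp_eq_Re)
  ultimately show ?thesis
    by (subst lebesgue_integral_eq_integral) (auto intro: integral_unique)
qed

section \<open>Disjoint tiles of length 1/N and their union\<close>

locale grid_tiles =
  fixes J :: "'k set" and l :: "'k \<Rightarrow> nat" and N :: nat
  assumes finite_J: "finite J" and N: "N > 0" and inj_l: "inj_on l J"
begin

definition left :: "'k \<Rightarrow> real" where "left k = real (l k) / real N"

definition tile :: "'k \<Rightarrow> real set" where "tile k = {left k..<left k + 1 / real N}"

definition domain :: "real set" where "domain = (\<Union>k\<in>J. tile k)"

text \<open>The grid number can be read off from any point of the tile; with injectivity of
  \<open>l\<close> this yields disjointness of the tiles.\<close>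

lemma tile_floor: "x \<in> tile k \<Longrightarrow> \<lfloor>real N * x\<rfloor> = int (l k)"
  using N by (simp add: tile_def left_def floor_eq_iff field_simps)

lemma tile_unique: "i \<in> J \<Longrightarrow> k \<in> J \<Longrightarrow> x \<in> tile i \<Longrightarrow> x \<in> tile k \<Longrightarrow> i = k"
  using inj_l tile_floor[of x i] tile_floor[of x k] by (auto simp: inj_on_def)

lemma indicator_tile: "i \<in> J \<Longrightarrow> k \<in> J \<Longrightarrow> x \<in> tile k \<Longrightarrow> indicator (tile i) x = of_bool (i = k)"
  using tile_unique by (auto simp: indicator_def)

lemma tile_sets [measurable]: "tile k \<in> sets lebesgue"
  by (simp add: tile_def)

lemma tile_subset: "k \<in> J \<Longrightarrow> tile k \<subseteq> domain"
  by (auto simp: domain_def)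

lemma tile_lmeasurable: "tile k \<in> lmeasurable"
  unfolding tile_def by (intro bounded_set_imp_lmeasurable) auto

lemma domain_lmeasurable: "domain \<in> lmeasurable"
  unfolding domain_def by (intro fmeasurable.finite_UN finite_J tile_lmeasurable)

lemma domain_sets: "domain \<in> sets lebesgue"
  using domain_lmeasurable by (rule fmeasurableD)

lemma tile_translate: "x \<in> tile j \<Longrightarrow> x + (left k - left j) \<in> tile k"
  by (auto simp: tile_def)

lemma integral_domain:
  fixes f :: "real \<Rightarrow> real"
  assumes "integrable (lebesgue_on domain) f"
  shows "(LINT x|lebesgue_on domain. f x) = (\<Sum>k\<in>J. LINT x|lebesgue_on (tile k). f x)"
proof -
  have int: "set_integrable lebesgue domain f"
    using assms domain_sets by (simp add: set_integrable_def integrable_restrict_space)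
  have "(LINT x:(\<Union>k\<in>J. tile k)|lebesgue. f x) = (\<Sum>k\<in>J. LINT x:tile k|lebesgue. f x)"
  proof (rule set_integral_finite_Union[OF finite_J])
    show "disjoint_family_on tile J"
      using tile_unique by (auto simp: disjoint_family_on_def)
    show "set_integrable lebesgue (tile k) f" if "k \<in> J" for k
      using int tile_sets tile_subset[OF that] by (rule set_integrable_subset)
  qed simp
  then show ?thesis
    using domain_sets
    by (simp add: domain_def[symmetric] set_lebesgue_integral_def integral_restrict_space)
qed

section \<open>An orthonormal basis of exponentials, one frequency coset per tile\<close>

lemma exponential_coset:
  assumes "x \<in> tile k"
  shows "exponential (tile k) (real N * of_int m + real r) x =
    exponential UNIV (real r) x * exp (2 * pi * \<i> * of_int m * of_real x / of_real (1 / real N))"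
proof -
  \<comment> \<open>The residue \<open>r\<close> yields a phase common to the whole coset; what
    remains is the ordinary trigonometric system whose period \<open>1 / N\<close> is the length of
    a tile.\<close>
  have "2 * complex_of_real pi * \<i> * of_real (real N * of_int m + real r) * of_real x
      = 2 * complex_of_real pi * \<i> * of_real (real r) * of_real x + 2 * pi * \<i> * of_int m * of_real x / of_real (1 / real N)"
    by (simp add: algebra_simps)
  then have "exp (2 * complex_of_real pi * \<i> * of_real (real N * of_int m + real r) * of_real x)
      = exp (2 * complex_of_real pi * \<i> * of_real (real r) * of_real x) * exp (2 * pi * \<i> * of_int m * of_real x / of_real (1 / real N))"
    by (simp only: exp_add)
  then show ?thesis using assms by (simp add: exponential_def)
qed

text \<open>The factor \<open>sqrt N\<close> normalises, since a tile has measure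
  \<open>1 / N\<close>.\<close>

definition tile_basis :: "'k \<times> real \<Rightarrow> real \<Rightarrow> complex" where
  "tile_basis = (\<lambda>(k, \<xi>) x. sqrt (real N) * exponential (tile k) \<xi> x)"

lemma tile_basis_L2: "tile_basis i \<in> L2 (lebesgue_on domain)"
  unfolding tile_basis_def
  by (auto split: prod.split intro!: L2_cmult exponential_L2 domain_lmeasurable)

text \<open>Functions on different tiles have disjoint supports. On a common tile the phases of the
  coset cancel, leaving the exponential of index \<open>m - n\<close> integrated over one
  period.\<close>

lemma tile_basis_orthonormal:
  assumes i: "i \<in> (SIGMA k:J. int_coset N (r k))" and j: "j \<in> (SIGMA k:J. int_coset N (r k))"
  shows "L2_inner (lebesgue_on domain) (tile_basis i) (tile_basis j) = (if i = j then 1 else 0)"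
proof -
  obtain k m where i': "i = (k, real N * of_int m + real (r k))" "k \<in> J"
    using i by (auto simp: int_coset_def)
  obtain k' n where j': "j = (k', real N * of_int n + real (r k'))" "k' \<in> J"
    using j by (auto simp: int_coset_def)
  show ?thesis
  proof (cases "k = k'")
    case False
    then have "tile_basis i x * cnj (tile_basis j x) = 0" for x
      using tile_unique[of k k' x] i' j' by (auto simp: tile_basis_def exponential_def indicator_def)
    then have "L2_inner (lebesgue_on domain) (tile_basis i) (tile_basis j) = 0"
      unfolding L2_inner_def by (simp only: Bochner_Integration.integral_zero)
    then show ?thesis using False i' j' by simp
  next
    case True
    let ?g = "\<lambda>x::real. exp (2 * pi * \<i> * of_int (m - n) * of_real x / of_real (1 / real N))"
    have prod: "tile_basis i x * cnj (tile_basis j x) = indicator (tile k) x *\<^sub>R (of_nat N * ?g x)" for x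
    proof (cases "x \<in> tile k")
      case x: True
      let ?R = "exponential UNIV (real (r k)) x" and ?q = "complex_of_real (sqrt (real N))"
      let ?E = "\<lambda>m::int. exp (2 * pi * \<i> * of_int m * of_real x / of_real (1 / real N))"
      have "tile_basis i x = ?q * (?R * ?E m)" "tile_basis j x = ?q * (?R * ?E n)"
        using x i' j' True by (simp_all only: tile_basis_def prod.case exponential_coset)
      then have "tile_basis i x * cnj (tile_basis j x)
          = (?q * cnj ?q) * (?R * cnj ?R) * (?E m * cnj (?E n))"
        by (simp only: complex_cnj_mult mult_ac)
      also have "?R * cnj ?R = 1"
        by (simp add: exponential_def exp_cnj flip: exp_add)
      also have "?q * cnj ?q = of_nat N"
        by (simp flip: of_real_mult)
      also have "?E m * cnj (?E n) = ?g x"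
        by (simp add: exp_cnj algebra_simps flip: exp_add)
      finally show ?thesis using x by simp
    qed (use i' j' True in \<open>simp add: tile_basis_def exponential_def\<close>)
    have "L2_inner (lebesgue_on domain) (tile_basis i) (tile_basis j)
        = (LINT x|lebesgue_on (tile k). of_nat N * ?g x)"
    proof -
      have "L2_inner (lebesgue_on domain) (tile_basis i) (tile_basis j)
          = (LINT x|lebesgue. indicator domain x *\<^sub>R (indicator (tile k) x *\<^sub>R (of_nat N * ?g x)))"
        using domain_sets by (simp add: L2_inner_def prod integral_restrict_space)
      also have "\<dots> = (LINT x|lebesgue. indicator (tile k) x *\<^sub>R (of_nat N * ?g x))"
        using tile_subset[OF i'(2)] by (intro Bochner_Integration.integral_cong) (auto simp: indicator_def)
      also have "\<dots> = (LINT x|lebesgue_on (tile k). of_nat N * ?g x)"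
        by (subst integral_restrict_space) (simp, rule refl)
      finally show ?thesis .
    qed
    also have "\<dots> = of_nat N * (LINT x|lebesgue_on (tile k). ?g x)"
      by (rule integral_mult_right_zero)
    also have "\<dots> = (if m = n then 1 else 0)"
    proof (cases "m = n")
      case True
      have "measure lebesgue (tile k) = 1 / real N"
        by (simp add: tile_def)
      then show ?thesis
        using True N by (simp add: measure_restrict_space scaleR_conv_of_real)
    next
      case False
      then show ?thesis
        using integral_exp_period[of "1 / real N" "m - n" "left k"] N by (simp add: tile_def)
    qed
    finally show ?thesis using i' j' True N by simp
  qed
qed

text \<open>On each tile the unimodular phase \<open>u k\<close> of the coset is divided out, the
  quotient is approximated by a trigonometric polynomial, and the phase is multiplied back without
  changing the error. The pieces combine because the tiles are disjoint.\<close>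

lemma tile_basis_dense:
  assumes f: "f \<in> L2 (lebesgue_on domain)" and \<epsilon>: "\<epsilon> > 0"
  shows "\<exists>F c. finite F \<and> F \<subseteq> (SIGMA k:J. int_coset N (r k)) \<and>
    L2_norm (lebesgue_on domain) (\<lambda>x. f x - (\<Sum>i\<in>F. c i * tile_basis i x)) < \<epsilon>"
proof -
  \<comment> \<open>The squared errors of the \<open>card J\<close> tiles add up to
    \<open>card J * \<eta>\<^sup>2\<close>; the \<open>+ 1\<close> keeps this strictly below the
    square of \<open>\<epsilon>\<close>.\<close>
  define \<eta> where "\<eta> = \<epsilon> / sqrt (real (card J) + 1)"
  have \<eta>: "\<eta> > 0" using \<epsilon> by (simp add: \<eta>_def)
  define P where "P F c x = (\<Sum>m\<in>F. c m * exp (2 * pi * \<i> * of_int m * of_real x / of_real (1 / real N)))"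
    for F :: "int set" and c and x :: real
  define u where "u k = exponential UNIV (real (r k))" for k
  have u1: "cmod (u k x) = 1" for k x
    by (simp add: u_def exponential_def)
  have uu: "u k x * cnj (u k x) = 1" for k x
    using u1[of k x] by (simp add: complex_norm_square[symmetric])
  have "\<exists>F c. finite F \<and> L2_norm (lebesgue_on (tile k)) (\<lambda>x. cnj (u k x) * f x - P F c x) < \<eta>"
    if k: "k \<in> J" for k
  proof -
    have "u k \<in> borel_measurable (lebesgue_on (tile k))"
      unfolding u_def by (intro exponential_measurable) auto
    then have "(\<lambda>x. cnj (u k x)) \<in> borel_measurable (lebesgue_on (tile k))"
      by (rule measurable_compose[OF _ borel_measurable_continuous_onI]) (intro continuous_intros)
    then have "(\<lambda>x. cnj (u k x) * f x) \<in> L2 (lebesgue_on (tile k))"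
      using L2_subset[OF f domain_sets tile_sets tile_subset[OF k]] u1 by (intro L2_mult_unimodular) auto
    then have "trig_approximable (left k) (1 / real N) (\<lambda>x. cnj (u k x) * f x)"
      using N by (intro trig_approximable_L2) (auto simp: tile_def)
    then show ?thesis
      using \<eta> unfolding trig_approximable_def P_def tile_def by blast
  qed
  then obtain F c where F: "\<And>k. k \<in> J \<Longrightarrow> finite (F k)"
    and c: "\<And>k. k \<in> J \<Longrightarrow> L2_norm (lebesgue_on (tile k)) (\<lambda>x. cnj (u k x) * f x - P (F k) (c k) x) < \<eta>"
    by metis
  define \<phi> where "\<phi> = (\<lambda>(k, m::int). (k, real N * of_int m + real (r k)))"
  define G where "G = \<phi> ` (SIGMA k:J. F k)"
  have inj: "inj \<phi>"
    using N by (auto simp: inj_on_def \<phi>_def)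
  \<comment> \<open>The inverse of \<open>\<phi>\<close> recovers the tile and the index
    \<open>m\<close> from a frequency, and the division cancels the normalisation in
    \<open>tile_basis\<close>.\<close>
  define C where "C i = (case inv_into UNIV \<phi> i of (k, m) \<Rightarrow> c k m / sqrt (real N))" for i
  have fin: "finite (SIGMA k:J. F k)"
    using F finite_J by auto
  have sum_eq: "(\<Sum>i\<in>G. C i * tile_basis i x) = u j x * P (F j) (c j) x"
    if j: "j \<in> J" "x \<in> tile j" for j x
  proof -
    have "(\<Sum>i\<in>G. C i * tile_basis i x) = (\<Sum>p\<in>(SIGMA k:J. F k). C (\<phi> p) * tile_basis (\<phi> p) x)"
      unfolding G_def by (simp add: sum.reindex[OF inj_on_subset[OF inj subset_UNIV]])
    also have "\<dots> = (\<Sum>k\<in>J. \<Sum>m\<in>F k. C (\<phi> (k, m)) * tile_basis (\<phi> (k, m)) x)"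
      using finite_J F by (simp add: sum.Sigma split_beta)
    also have "\<dots> = (\<Sum>k\<in>J. if k = j then u j x * P (F j) (c j) x else 0)"
    proof (intro sum.cong refl)
      fix k assume k: "k \<in> J"
      have C: "C (\<phi> (k, m)) = c k m / sqrt (real N)" for m
        by (simp add: C_def inv_f_f[OF inj])
      show "(\<Sum>m\<in>F k. C (\<phi> (k, m)) * tile_basis (\<phi> (k, m)) x) = (if k = j then u j x * P (F j) (c j) x else 0)"
      proof (cases "k = j")
        case True
        have "C (\<phi> (j, m)) * tile_basis (\<phi> (j, m)) x
            = u j x * (c j m * exp (2 * pi * \<i> * of_int m * of_real x / of_real (1 / real N)))" for m
          using N C[of m] True exponential_coset[OF j(2), of m "r j"]
          by (simp add: \<phi>_def tile_basis_def u_def)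
        then show ?thesis
          by (simp add: True P_def sum_distrib_left)
      next
        case False
        then have "x \<notin> tile k"
          using tile_unique[OF k j(1)] j(2) by auto
        then show ?thesis
          using False by (simp add: \<phi>_def tile_basis_def exponential_def)
      qed
    qed
    also have "\<dots> = u j x * P (F j) (c j) x"
      using j finite_J by simp
    finally show ?thesis .
  qed
  define h where "h x = f x - (\<Sum>i\<in>G. C i * tile_basis i x)" for x
  have h: "h \<in> L2 (lebesgue_on domain)"
    unfolding h_def by (intro L2_diff f L2_sum L2_cmult tile_basis_L2)
  have "(LINT x|lebesgue_on domain. (cmod (h x))\<^sup>2) = (\<Sum>k\<in>J. LINT x|lebesgue_on (tile k). (cmod (h x))\<^sup>2)"
    by (rule integral_domain[OF L2_integrable[OF h]])
  also have "\<dots> \<le> (\<Sum>k\<in>J. \<eta>\<^sup>2)"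
  proof (rule sum_mono)
    fix k assume k: "k \<in> J"
    have "cmod (h x) = cmod (cnj (u k x) * f x - P (F k) (c k) x)" if "x \<in> tile k" for x
    proof -
      have "u k x * (cnj (u k x) * f x - P (F k) (c k) x)
          = (u k x * cnj (u k x)) * f x - u k x * P (F k) (c k) x"
        by (simp only: right_diff_distrib mult.assoc)
      also have "\<dots> = h x"
        by (simp only: uu mult_1_left h_def sum_eq[OF k that])
      finally have "cmod (h x) = cmod (u k x * (cnj (u k x) * f x - P (F k) (c k) x))"
        by (rule arg_cong[OF sym])
      then show ?thesis by (simp only: norm_mult u1 mult_1_left)
    qed
    then have "(LINT x|lebesgue_on (tile k). (cmod (h x))\<^sup>2)
        = (LINT x|lebesgue_on (tile k). (cmod (cnj (u k x) * f x - P (F k) (c k) x))\<^sup>2)"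
      by (intro Bochner_Integration.integral_cong) auto
    also have "\<dots> = (L2_norm (lebesgue_on (tile k)) (\<lambda>x. cnj (u k x) * f x - P (F k) (c k) x))\<^sup>2"
      by (simp add: L2_norm_def)
    also have "\<dots> \<le> \<eta>\<^sup>2"
      using c[OF k] by (intro power_mono) auto
    finally show "(LINT x|lebesgue_on (tile k). (cmod (h x))\<^sup>2) \<le> \<eta>\<^sup>2" .
  qed
  also have "\<dots> < \<epsilon>\<^sup>2"
    using \<epsilon> by (simp add: \<eta>_def power_divide field_simps)
  finally have "L2_norm (lebesgue_on domain) h < sqrt (\<epsilon>\<^sup>2)"
    unfolding L2_norm_def by (rule real_sqrt_less_mono)
  then have "L2_norm (lebesgue_on domain) (\<lambda>x. f x - (\<Sum>i\<in>G. C i * tile_basis i x)) < \<epsilon>"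
    using \<epsilon> by (simp add: h_def[abs_def])
  moreover have "G \<subseteq> (SIGMA k:J. int_coset N (r k))"
    by (auto simp: G_def \<phi>_def int_coset_def)
  moreover have "finite G"
    unfolding G_def using fin by (rule finite_imageI)
  ultimately show ?thesis
    by (intro exI[of _ G] exI[of _ C] conjI)
qed

lemma tile_basis_orthonormal_basis:
  "L2_orthonormal_basis (lebesgue_on domain) (SIGMA k:J. int_coset N (r k)) tile_basis"
proof -
  have "int_coset N s = range (\<lambda>m::int. real N * of_int m + real s)" for s
    by (auto simp: int_coset_def)
  then have "countable (SIGMA k:J. int_coset N (r k))"
    using finite_J by (intro countable_SIGMA) (auto simp: countable_finite)
  then show ?thesis
    unfolding L2_orthonormal_basis_def
    using tile_basis_L2 tile_basis_orthonormal tile_basis_dense by auto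
qed

section \<open>Matrices acting on the vector of restrictions to the tiles\<close>

definition matrix_op :: "('k \<Rightarrow> 'k \<Rightarrow> complex) \<Rightarrow> (real \<Rightarrow> complex) \<Rightarrow> real \<Rightarrow> complex" where
  "matrix_op a f x = (\<Sum>j\<in>J. \<Sum>k\<in>J. a j k * (indicator (tile j) x * f (x + (left k - left j))))"

lemma matrix_op_bounded: "L2_bounded_operator (lebesgue_on domain) (matrix_op a)"
proof -
  have "L2_bounded_operator (lebesgue_on domain)
      (\<lambda>f x. \<Sum>j\<in>J. \<Sum>k\<in>J. a j k * (indicator (tile j) x * f (x + (left k - left j))))"
    using tile_translate tile_subset
    by (intro L2_bounded_operator_sum finite_J L2_bounded_operator_cmult
        L2_bounded_operator_translation domain_sets tile_sets) blast+
  then show ?thesis by (simp add: matrix_op_def[abs_def])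
qed

text \<open>Only the outer summand of the tile containing \<open>x\<close> survives. Read for all
  \<open>j\<close> at once, the formula says that \<open>a\<close> multiplies the column of
  restrictions of \<open>f\<close>, identified with one another by translation.\<close>

lemma matrix_op_on_tile:
  assumes "j \<in> J" "x \<in> tile j"
  shows "matrix_op a f x = (\<Sum>k\<in>J. a j k * f (x + (left k - left j)))"
proof -
  have "matrix_op a f x = (\<Sum>i\<in>J. if i = j then (\<Sum>k\<in>J. a j k * f (x + (left k - left j))) else 0)"
    unfolding matrix_op_def using assms by (intro sum.cong) (auto simp: indicator_tile)
  then show ?thesis using assms finite_J by simp
qed

text \<open>Moving from tile \<open>j\<close> to \<open>k\<close> and then to \<open>m\<close> is
  moving from \<open>j\<close> to \<open>m\<close>, so operators compose as their matrices
  multiply.\<close>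

lemma matrix_op_inverse:
  assumes ab: "\<And>i j. i \<in> J \<Longrightarrow> j \<in> J \<Longrightarrow> (\<Sum>k\<in>J. a i k * b k j) = of_bool (i = j)"
    and x: "x \<in> domain"
  shows "matrix_op a (matrix_op b f) x = f x"
proof -
  obtain j where j: "j \<in> J" "x \<in> tile j"
    using x by (auto simp: domain_def)
  have "matrix_op a (matrix_op b f) x = (\<Sum>k\<in>J. \<Sum>m\<in>J. a j k * b k m * f (x + (left m - left j)))"
    unfolding matrix_op_on_tile[OF j] sum_distrib_left
    by (intro sum.cong refl)
      (simp add: matrix_op_on_tile[OF _ tile_translate[OF j(2)]] sum_distrib_left mult.assoc)
  also have "\<dots> = (\<Sum>m\<in>J. (\<Sum>k\<in>J. a j k * b k m) * f (x + (left m - left j)))"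
    by (subst sum.swap) (simp add: sum_distrib_right)
  also have "\<dots> = (\<Sum>m\<in>J. if m = j then f x else 0)"
    using ab j by (intro sum.cong) auto
  finally show ?thesis using j finite_J by simp
qed

lemma matrix_op_bijective:
  assumes ab: "\<And>i j. i \<in> J \<Longrightarrow> j \<in> J \<Longrightarrow> (\<Sum>k\<in>J. a i k * b k j) = of_bool (i = j)"
    and ba: "\<And>i j. i \<in> J \<Longrightarrow> j \<in> J \<Longrightarrow> (\<Sum>k\<in>J. b i k * a k j) = of_bool (i = j)"
  shows "L2_bijective (lebesgue_on domain) (matrix_op a)"
proof (rule L2_bijectiveI[OF matrix_op_bounded[of b]])
  show "matrix_op a f \<in> L2 (lebesgue_on domain)" if "f \<in> L2 (lebesgue_on domain)" for f
    using that matrix_op_bounded[of a] by (simp add: L2_bounded_operator_def)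
  have "matrix_op b (matrix_op a f) x = f x" if "x \<in> domain" for f x
    by (rule matrix_op_inverse[OF _ that]) (rule ba)
  then show "L2_eq (lebesgue_on domain) (matrix_op b (matrix_op a f)) f" for f
    unfolding L2_eq_def by (intro AE_I2) (simp only: space_lebesgue_on)
  have "matrix_op a (matrix_op b f) x = f x" if "x \<in> domain" for f x
    by (rule matrix_op_inverse[OF _ that]) (rule ab)
  then show "L2_eq (lebesgue_on domain) (matrix_op a (matrix_op b f)) f" for f
    unfolding L2_eq_def by (intro AE_I2) (simp only: space_lebesgue_on)
qed

text \<open>Column \<open>k\<close> of \<open>a\<close> copies a function living on tile
  \<open>k\<close> to all tiles indexed by \<open>A k\<close>, with exactly the phases that turn the
  copies into restrictions of one exponential. Invertibility of \<open>a\<close> makes the operator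
  bijective.\<close>

lemma Riesz_basis:
  fixes A :: "'k \<Rightarrow> 'k set" and \<rho> :: "'k \<Rightarrow> nat"
  assumes A: "\<And>k. k \<in> J \<Longrightarrow> A k \<subseteq> J"
  defines "w \<equiv> \<lambda>j. exp (2 * pi * \<i> * left j)"
  defines "a \<equiv> \<lambda>j k. of_bool (j \<in> A k) * w j ^ \<rho> k / w k ^ \<rho> k"
  assumes ab: "\<And>i j. i \<in> J \<Longrightarrow> j \<in> J \<Longrightarrow> (\<Sum>k\<in>J. a i k * b k j) = of_bool (i = j)"
    and ba: "\<And>i j. i \<in> J \<Longrightarrow> j \<in> J \<Longrightarrow> (\<Sum>k\<in>J. b i k * a k j) = of_bool (i = j)"
  shows "L2_Riesz_basis (lebesgue_on domain) (SIGMA k:J. int_coset N (\<rho> k))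
    (\<lambda>(k, \<xi>). exponential (\<Union>j\<in>A k. tile j) \<xi>)"
proof -
  define q where "q = complex_of_real (sqrt (real N))"
  have q: "q \<noteq> 0" using N by (simp add: q_def)
  \<comment> \<open>Dividing by \<open>q\<close> undoes the normalisation of
    \<open>tile_basis\<close>; the inverse matrix is scaled by \<open>q\<close> accordingly.\<close>
  define U where "U = matrix_op (\<lambda>j k. a j k / q)"
  have "L2_bijective (lebesgue_on domain) U"
    unfolding U_def
    by (rule matrix_op_bijective[where b = "\<lambda>j k. q * b j k"]) (use q ab ba in simp_all)
  moreover have "L2_bounded_operator (lebesgue_on domain) U"
    unfolding U_def by (rule matrix_op_bounded)
  moreover have "exponential (\<Union>j\<in>A k. tile j) \<xi> \<in> L2 (lebesgue_on domain)" if "k \<in> J" for k \<xi>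
    using finite_subset[OF A[OF that] finite_J]
    by (intro exponential_L2 domain_lmeasurable sets.finite_UN) auto
  moreover have "L2_eq (lebesgue_on domain) (exponential (\<Union>j\<in>A k. tile j) \<xi>) (U (tile_basis (k, \<xi>)))"
    if k: "k \<in> J" and \<xi>: "\<xi> \<in> int_coset N (\<rho> k)" for k \<xi>
    unfolding L2_eq_def
  proof (rule AE_I2)
    fix x assume "x \<in> space (lebesgue_on domain)"
    then obtain j where j: "j \<in> J" "x \<in> tile j"
      by (auto simp: domain_def)
    obtain m where m: "\<xi> = real N * of_int m + real (\<rho> k)"
      using \<xi> by (auto simp: int_coset_def)
    define y where "y = x + (left k - left j)"
    have "U (tile_basis (k, \<xi>)) x = (\<Sum>i\<in>J. a j i / q * tile_basis (k, \<xi>) (x + (left i - left j)))"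
      unfolding U_def by (rule matrix_op_on_tile[OF j])
    also have "\<dots> = (\<Sum>i\<in>J. if i = k then a j k * exponential UNIV \<xi> y else 0)"
    proof (intro sum.cong refl)
      fix i assume i: "i \<in> J"
      have "indicator (tile k) (x + (left i - left j)) = (of_bool (k = i) :: complex)"
        by (rule indicator_tile[OF k i tile_translate[OF j(2)]])
      then show "a j i / q * tile_basis (k, \<xi>) (x + (left i - left j)) = (if i = k then a j k * exponential UNIV \<xi> y else 0)"
        using q by (auto simp: tile_basis_def exponential_def y_def q_def)
    qed
    also have "\<dots> = a j k * exponential UNIV \<xi> y"
      using k finite_J by simp
    also have "\<dots> = exponential (\<Union>j\<in>A k. tile j) \<xi> x"
    proof (cases "j \<in> A k")
      case True
      have "w i ^ \<rho> k = exp (of_nat (\<rho> k) * (2 * pi * \<i> * left i))" for i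
        by (simp add: w_def exp_of_nat_mult)
      then have "a j k * exponential UNIV \<xi> y
          = exp (of_nat (\<rho> k) * (2 * pi * \<i> * left j) - of_nat (\<rho> k) * (2 * pi * \<i> * left k)
              + 2 * complex_of_real pi * \<i> * of_real \<xi> * of_real y)"
        using True by (simp add: a_def exponential_def exp_diff exp_add)
      \<comment> \<open>Passing from \<open>x\<close> to \<open>y\<close> adds
        \<open>\<xi> * (left k - left j)\<close> to the phase. The part from \<open>\<rho> k\<close>
        is cancelled by the quotient of powers of \<open>w\<close>, and
        \<open>N * m * (left k - left j)\<close> is the integer \<open>m * (l k - l j)\<close>, so
        it is invisible to the exponential.\<close>
      also have "of_nat (\<rho> k) * (2 * pi * \<i> * left j) - of_nat (\<rho> k) * (2 * pi * \<i> * left k)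
              + 2 * complex_of_real pi * \<i> * of_real \<xi> * of_real y
          = 2 * complex_of_real pi * \<i> * of_real \<xi> * of_real x + 2 * of_int (m * (int (l k) - int (l j))) * pi * \<i>"
        using N by (simp add: m y_def left_def field_simps)
      also have "exp \<dots> = exp (2 * complex_of_real pi * \<i> * of_real \<xi> * of_real x)"
        by (simp only: exp_add exp_integer_2pi[OF Ints_of_int] mult_1_right)
      finally show ?thesis
        using True j by (auto simp: exponential_def indicator_def)
    next
      case False
      then have "x \<notin> (\<Union>j\<in>A k. tile j)"
        using tile_unique[OF j(1) _ j(2)] A[OF k] by blast
      then show ?thesis
        using False by (simp add: a_def exponential_def)
    qed
    finally show "exponential (\<Union>j\<in>A k. tile j) \<xi> x = U (tile_basis (k, \<xi>)) x" by simp
  qed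
  ultimately show ?thesis
    unfolding L2_Riesz_basis_def using tile_basis_orthonormal_basis[of \<rho>]
    by (intro conjI exI[of _ tile_basis] exI[of _ U]) auto
qed

end

theorem theorem1:
  fixes K N :: nat and I S :: "nat \<Rightarrow> real set"
  assumes "1 \<le> K" and "K \<le> N"
    and "\<forall>k\<in>{1..K}. I k \<in> grid_intervals N"
    and "inj_on I {1..K}"
    and "\<forall>k\<in>{1..K}. \<exists>C. C \<subseteq> I ` {1..K} \<and> I k \<in> C \<and> S k = \<Union>C"
  shows "\<exists>\<rho>. \<rho> permutes {1..K} \<and>
    L2_Riesz_basis (lebesgue_on (\<Union>k\<in>{1..K}. S k))
      (SIGMA k:{1..K}. int_coset N (\<rho> k))
      (\<lambda>(k, \<xi>). exponential (S k) \<xi>)"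
proof -
  have N: "N > 0" using assms(1,2) by simp
  have "\<forall>k\<in>{1..K}. \<exists>n<N. I k = {real n / real N ..< (real n + 1) / real N}"
    using assms(3) by (auto simp: grid_intervals_def)
  then obtain l where l: "\<And>k. k \<in> {1..K} \<Longrightarrow> l k < N"
    and I: "\<And>k. k \<in> {1..K} \<Longrightarrow> I k = {real (l k) / real N ..< (real (l k) + 1) / real N}"
    by metis
  have inj_l: "inj_on l {1..K}"
  proof (rule inj_onI)
    fix i j assume ij: "i \<in> {1..K}" "j \<in> {1..K}" "l i = l j"
    then have "I i = I j" by (simp only: I)
    with ij show "i = j" using inj_onD[OF assms(4)] by blast
  qed
  interpret grid_tiles "{1..K}" l N
    by unfold_locales (use N inj_l in auto)
  have I_tile: "I k = tile k" if "k \<in> {1..K}" for k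
    using I[OF that] by (simp add: tile_def left_def add_divide_distrib)
  obtain C where C: "\<And>k. k \<in> {1..K} \<Longrightarrow> C k \<subseteq> I ` {1..K} \<and> I k \<in> C k \<and> S k = \<Union>(C k)"
    using assms(5) by metis
  \<comment> \<open>The intervals making up \<open>S k\<close> are recorded by their indices, which
    gives the pattern of the 0-1 matrix.\<close>
  define A where "A k = {j \<in> {1..K}. I j \<in> C k}" for k
  have A: "k \<in> A k" if "k \<in> {1..K}" for k
    using C[OF that] that by (simp add: A_def)
  have S: "S k = (\<Union>j\<in>A k. tile j)" if "k \<in> {1..K}" for k
  proof -
    have "C k = I ` A k"
      using conjunct1[OF C[OF that]] by (auto simp: A_def)
    also have "\<dots> = tile ` A k"
      by (rule image_cong) (auto simp: A_def I_tile)
    finally show ?thesis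
      using C[OF that] by simp
  qed
  define w where "w j = exp (2 * pi * \<i> * left j)" for j
  have "inj_on w {1..K}"
  proof (rule inj_onI)
    fix i j assume ij: "i \<in> {1..K}" "j \<in> {1..K}" "w i = w j"
    \<comment> \<open>Both left endpoints lie in \<open>[0, 1)\<close>, so the angles differ by less
      than a full turn and the points \<open>w i\<close> on the circle determine them.\<close>
    have "\<bar>left i - left j\<bar> < 1"
      using l[OF ij(1)] l[OF ij(2)] N by (simp add: left_def abs_less_iff field_simps)
    then have "2 * pi * \<bar>left i - left j\<bar> < 2 * pi * 1"
      by (intro mult_strict_left_mono) auto
    then have "\<bar>Im (2 * pi * \<i> * left i) - Im (2 * pi * \<i> * left j)\<bar> < 2 * pi"
      by (simp add: abs_mult flip: right_diff_distrib)
    then have "2 * pi * \<i> * left i = 2 * pi * \<i> * left j"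
      using ij(3) unfolding w_def by (rule exp_complex_eqI)
    then have "l i = l j"
      using N by (simp add: left_def)
    then show "i = j"
      using inj_onD[OF inj_l] ij by blast
  qed
  then obtain \<rho> b where \<rho>: "\<rho> permutes {1..K}" and
    inv: "\<And>i j. i \<in> {1..K} \<Longrightarrow> j \<in> {1..K} \<Longrightarrow>
      (\<Sum>k\<in>{1..K}. of_bool (i \<in> A k) * w i ^ \<rho> k / w k ^ \<rho> k * b k j) = of_bool (i = j)"
    "\<And>i j. i \<in> {1..K} \<Longrightarrow> j \<in> {1..K} \<Longrightarrow>
      (\<Sum>k\<in>{1..K}. b i k * (of_bool (k \<in> A j) * w k ^ \<rho> j / w j ^ \<rho> j)) = of_bool (i = j)"
    by (rule exists_permuted_inverse[of w K A]) (auto simp: w_def A)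
  have "L2_Riesz_basis (lebesgue_on domain) (SIGMA k:{1..K}. int_coset N (\<rho> k))
      (\<lambda>(k, \<xi>). exponential (\<Union>j\<in>A k. tile j) \<xi>)"
    by (rule Riesz_basis[OF _ inv[unfolded w_def]]) (auto simp: A_def)
  then have "L2_Riesz_basis (lebesgue_on domain) (SIGMA k:{1..K}. int_coset N (\<rho> k))
      (\<lambda>(k, \<xi>). exponential (S k) \<xi>)"
    by (rule L2_Riesz_basis_cong) (auto simp: S)
  moreover have "domain = (\<Union>k\<in>{1..K}. S k)"
  proof -
    have "tile k \<subseteq> S k" "S k \<subseteq> domain" if "k \<in> {1..K}" for k
      unfolding S[OF that] domain_def using A[OF that] by (auto simp: A_def)
    then show ?thesis unfolding domain_def by blast
  qed
  ultimately show ?thesis using \<rho> by auto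
qed

end
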